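(* Let $(\phi(t))_{t\ge0}$ be the winding number process of the Brownian motion on $\mathbb{CP}^1$ started at Riemannian distance $r_0\in(0,\pi/2)$ from $0$. When $t\to\infty$, in distribution we have $$\frac{\phi(t)}{t}\to\mathcal{C}_2,$$ where $\mathcal{C}_2$ is a Cauchy distribution with parameter $2$.
   Context: $\mathbb{CP}^1$ is isometric to the two-dimensional Euclidean sphere of radius $\frac12$. In spherical coordinates $(r,\phi)$, where $r\in[0,\pi/2]$ is the Riemannian distance from the north pole (which corresponds to the point $0\in\mathbb{CP}^1$) and $\phi$ is the angular coordinate around it, the generator of Brownian motion on $\mathbb{CP}^1$ is $$\frac12\left(\frac{\partial^2}{\partial r^2}+2\cot 2r\,\frac{\partial}{\partial r}+\frac{4}{\sin^22r}\frac{\partial^2}{\partial\phi^2}\right).$$ The winding number process (the continuous real-valued determination, starting at $0$, of the angle wound around $0$ by the Brownian motion) is given by $$\phi(t)=\beta_{\int_0^t\frac{4\,ds}{\sin^22r(s)}},$$ where $r(t)$ is the Jacobi diffusion started at $r_0\in(0,\pi/2)$ with generator $\frac12\left(\frac{\partial^2}{\partial r^2}+2\cot2r\,\frac{\partial}{\partial r}\right)$ and $\beta$ is a standard real Brownian motion independent from $r$. The Cauchy distribution with parameter $a>0$ is the law on $\mathbb{R}$ with characteristic function $\lambda\mapsto e^{-a|\lambda|}$. *)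

theory Defs
  imports "HOL-Probability.Probability"
begin

text \<open>Stochastic processes are indexed by time \<open>t :: real\<close>; only \<open>t \<ge> 0\<close> is relevant.\<close>

definition natural_filtration :: "'a measure \<Rightarrow> (real \<Rightarrow> 'a \<Rightarrow> real) \<Rightarrow> real \<Rightarrow> 'a measure" where
  "natural_filtration M X t =
     sigma (space M) (\<Union>s\<in>{0..t}. {X s -` A \<inter> space M |A. A \<in> sets borel})"

definition martingale :: "'a measure \<Rightarrow> (real \<Rightarrow> 'a measure) \<Rightarrow> (real \<Rightarrow> 'a \<Rightarrow> real) \<Rightarrow> bool" where
  "martingale M F N \<longleftrightarrow>
     (\<forall>t\<ge>0. N t \<in> borel_measurable (F t) \<and> integrable M (N t)) \<and>
     (\<forall>s\<ge>0. \<forall>t\<ge>s. AE \<omega> in M. real_cond_exp M (F s) (N t) \<omega> = N s \<omega>)"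

text \<open>Functions of class \<open>C\<^sup>2\<close> with compact support in the open set \<open>I\<close>, extended by \<open>0\<close> to \<open>\<real>\<close>.\<close>

definition C2_compact_support :: "real set \<Rightarrow> (real \<Rightarrow> real) \<Rightarrow> bool" where
  "C2_compact_support I f \<longleftrightarrow>
     (\<forall>x. f field_differentiable (at x)) \<and>
     (\<forall>x. deriv f field_differentiable (at x)) \<and>
     continuous_on UNIV (deriv (deriv f)) \<and>
     (\<exists>K. compact K \<and> K \<subseteq> I \<and> (\<forall>x. x \<notin> K \<longrightarrow> f x = 0))"

text \<open>
  Diffusion on the open interval \<open>I\<close> with generator \<open>L\<close>, started at \<open>x0\<close>: a process with continuous
  paths in \<open>I\<close> that solves the martingale problem for \<open>L\<close>.
\<close>

definition diffusion ::
  "'a measure \<Rightarrow> real set \<Rightarrow> ((real \<Rightarrow> real) \<Rightarrow> real \<Rightarrow> real) \<Rightarrow> real \<Rightarrow> (real \<Rightarrow> 'a \<Rightarrow> real) \<Rightarrow> bool"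
where
  "diffusion M I L x0 X \<longleftrightarrow>
     (\<forall>t\<ge>0. X t \<in> borel_measurable M) \<and>
     (\<forall>\<omega>\<in>space M. continuous_on {0..} (\<lambda>t. X t \<omega>) \<and> (\<forall>t\<ge>0. X t \<omega> \<in> I)) \<and>
     (AE \<omega> in M. X 0 \<omega> = x0) \<and>
     (\<forall>f. C2_compact_support I f \<longrightarrow>
        martingale M (natural_filtration M X)
          (\<lambda>t \<omega>. f (X t \<omega>) - f (X 0 \<omega>) - (LINT s:{0..t}|lborel. L f (X s \<omega>))))"

definition jacobi_generator :: "(real \<Rightarrow> real) \<Rightarrow> real \<Rightarrow> real" where
  "jacobi_generator f r = 1 / 2 * (deriv (deriv f) r + 2 * cot (2 * r) * deriv f r)"

text \<open>
  Both poles \<open>r = 0\<close> and \<open>r = pi/2\<close> are inaccessible from the interior, so that the state space of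
  the Jacobi diffusion started in the interior is the open interval.
\<close>

definition jacobi_diffusion :: "'a measure \<Rightarrow> real \<Rightarrow> (real \<Rightarrow> 'a \<Rightarrow> real) \<Rightarrow> bool" where
  "jacobi_diffusion M r0 r \<longleftrightarrow> diffusion M {0<..<pi/2} jacobi_generator r0 r"

definition std_brownian_motion :: "'a measure \<Rightarrow> (real \<Rightarrow> 'a \<Rightarrow> real) \<Rightarrow> bool" where
  "std_brownian_motion M B \<longleftrightarrow>
     (\<forall>t\<ge>0. B t \<in> borel_measurable M) \<and>
     (\<forall>\<omega>\<in>space M. continuous_on {0..} (\<lambda>t. B t \<omega>)) \<and>
     (AE \<omega> in M. B 0 \<omega> = 0) \<and>
     (\<forall>s\<ge>0. \<forall>t>s. distributed M lborel (\<lambda>\<omega>. B t \<omega> - B s \<omega>) (normal_density 0 (sqrt (t - s)))) \<and>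
     (\<forall>(t :: nat \<Rightarrow> real) n. 0 \<le> t 0 \<and> mono t \<longrightarrow>
        prob_space.indep_vars M (\<lambda>_. borel) (\<lambda>i \<omega>. B (t (Suc i)) \<omega> - B (t i) \<omega>) {..<n})"

text \<open>Independence of the two processes as random elements of the path space \<open>\<real>\<^bsup>[0,\<infinity>)\<^esup>\<close>.\<close>

definition independent_processes ::
  "'a measure \<Rightarrow> (real \<Rightarrow> 'a \<Rightarrow> real) \<Rightarrow> (real \<Rightarrow> 'a \<Rightarrow> real) \<Rightarrow> bool"
where
  "independent_processes M X Y \<longleftrightarrow>
     prob_space.indep_var M
       (\<Pi>\<^sub>M t\<in>{0..}. borel) (\<lambda>\<omega>. \<lambda>t\<in>{0..}. X t \<omega>)
       (\<Pi>\<^sub>M t\<in>{0..}. borel) (\<lambda>\<omega>. \<lambda>t\<in>{0..}. Y t \<omega>)"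

text \<open>
  Winding number process around \<open>0\<close> of the Brownian motion on the complex projective line started at
  distance \<open>r0\<close> from \<open>0\<close>: the angular coordinate, given by the skew product of the radial part
  \<open>r\<close> and an independent Brownian motion \<open>\<beta>\<close> run with the clock of the angular part of the
  generator \<open>1/2 * (\<partial>\<^sub>r\<^sup>2 + 2 cot(2r) \<partial>\<^sub>r + 4/sin(2r)\<^sup>2 \<partial>\<^sub>\<phi>\<^sup>2)\<close>.
\<close>

definition CP1_winding_process :: "'a measure \<Rightarrow> real \<Rightarrow> (real \<Rightarrow> 'a \<Rightarrow> real) \<Rightarrow> bool" where
  "CP1_winding_process M r0 \<phi> \<longleftrightarrow>
     (\<exists>r \<beta>. jacobi_diffusion M r0 r \<and> std_brownian_motion M \<beta> \<and> independent_processes M r \<beta> \<and>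
        (\<forall>t\<ge>0. \<forall>\<omega>\<in>space M.
           \<phi> t \<omega> = \<beta> (LINT s:{0..t}|lborel. 4 / (sin (2 * r s \<omega>))\<^sup>2) \<omega>))"

definition cauchy_distribution :: "real \<Rightarrow> real measure \<Rightarrow> bool" where
  "cauchy_distribution a \<mu> \<longleftrightarrow>
     0 < a \<and> real_distribution \<mu> \<and> (\<forall>l. char \<mu> l = complex_of_real (exp (- a * \<bar>l\<bar>)))"

text \<open>Convergence in distribution along an arbitrary filter, extending \<^const>\<open>weak_conv_m\<close>.\<close>

definition converges_in_distribution ::
  "'a measure \<Rightarrow> ('i \<Rightarrow> 'a \<Rightarrow> real) \<Rightarrow> real measure \<Rightarrow> 'i filter \<Rightarrow> bool"
where
  "converges_in_distribution M X \<mu> F \<longleftrightarrow>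
     (\<forall>x. isCont (cdf \<mu>) x \<longrightarrow> ((\<lambda>i. cdf (distr M borel (X i)) x) \<longlongrightarrow> cdf \<mu> x) F)"

lemma converges_in_distribution_sequentially:
  "converges_in_distribution M X \<mu> sequentially \<longleftrightarrow> weak_conv_m (\<lambda>n. distr M borel (X n)) \<mu>"
  by (simp add: converges_in_distribution_def weak_conv_m_def weak_conv_def)

end

theory Submission
  imports Defs "HOL-Real_Asymp.Real_Asymp"
begin

text \<open>
  Write \<open>A t = \<integral>\<^sub>0\<^sup>t 4 / sin\<^sup>2(2 r(s)) ds\<close>, so that \<open>\<phi>(t) = \<beta>(A t)\<close>. Since \<open>\<beta>\<close> is independent
  of \<open>r\<close>, the characteristic function of \<open>\<phi>(t)/t\<close> at \<open>l\<close> is \<open>E[exp(- \<mu>\<^sup>2/2 A t)]\<close> with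
  \<open>\<mu> = \<bar>l\<bar>/t\<close> (\<open>brownian_time_change_measurable_and_char\<close>), and by Levy's continuity theorem it
  suffices that this Laplace transform tends to \<open>exp(- 2 \<bar>l\<bar>)\<close>.
  
  The Laplace transform is accessible because \<open>g(r) = (sin 2r)\<^sup>\<mu>\<close> satisfies
  \<open>L g = (\<mu>\<^sup>2/2 * 4/sin\<^sup>2(2r) - 2 \<mu> (\<mu> + 1)) g\<close> for the generator \<open>L\<close> of \<open>r\<close>. Hence
  \<open>exp(2 \<mu> (\<mu> + 1) t - \<mu>\<^sup>2/2 A t) g(r(t))\<close> has constant expectation, that is
  \<open>E[exp(- \<mu>\<^sup>2/2 A t) g(r(t))] = g(r0) exp(- 2 \<mu> (\<mu> + 1) t)\<close> (\<open>exponential_functional\<close>). For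
  \<open>\<mu> = l/t\<close> the right-hand side tends to \<open>exp(- 2 l)\<close>, which settles the lower bound as \<open>g \<le> 1\<close>.
  
  For the upper bound the factor \<open>g(r(t))\<close> has to be removed. From
  \<open>L(sin 2r) = 2/sin 2r - 4 sin 2r\<close> one gets \<open>E \<integral>\<^sub>0\<^sup>t 1/sin(2 r(s)) ds \<le> 1/2 + 2t\<close>, hence a bound of
  the order \<open>\<mu> t\<close> for \<open>E \<integral>\<^sub>0\<^sup>t (1 - g(r(s))) ds\<close> (\<open>occupation_bound\<close>). This controls \<open>g(r(s))\<close> on
  time average only, but \<open>exp(- \<mu>\<^sup>2/2 A t)\<close> is decreasing in \<open>t\<close>, so its value at \<open>t\<close> is at most
  its average over \<open>[t - sqrt t, t]\<close>, a window that is long enough for the bound and short enough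
  not to change the limit (\<open>laplace_upper\<close>, \<open>laplace_limit\<close>).
  
  The diffusion is only given through its martingale problem with compactly supported test
  functions. No stopping times are used to reach \<open>(sin 2r)\<^sup>\<mu>\<close>: in the coordinate
  \<open>u = - ln(sin 2r)\<close> it is \<open>exp(- \<mu> u)\<close>, it is multiplied by the cut-off \<open>max 0 (1 - u/n) ^ 3\<close>, and
  the error terms are of the size \<open>exp(2u)/n\<close>, which the killing rate \<open>2 \<mu>\<^sup>2 exp(2u)\<close> itself
  integrates to \<open>O(1/n)\<close>. The passage from the martingale problem to exponential functionals is the
  Feynman-Kac formula \<open>Feynman_Kac\<close>, where integration by parts against a process of finite variation
  replaces stochastic calculus.
\<close>

section \<open>Processes with continuous paths\<close>

text \<open>
  The measurability is with respect to a fixed \<open>N\<close>; adaptedness to a filtration \<open>F\<close> is expressed by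
  \<open>cont_process (F s) s X\<close> for all \<open>s\<close>.
\<close>

definition cont_process :: "'a measure \<Rightarrow> real \<Rightarrow> (real \<Rightarrow> 'a \<Rightarrow> real) \<Rightarrow> bool" where
  "cont_process N T X \<longleftrightarrow> (\<forall>s\<in>{0..T}. X s \<in> borel_measurable N) \<and>
     (\<forall>\<omega>\<in>space N. continuous_on {0..T} (\<lambda>s. X s \<omega>))"

lemma cont_processI:
  "(\<And>s. 0 \<le> s \<Longrightarrow> s \<le> T \<Longrightarrow> X s \<in> borel_measurable N) \<Longrightarrow>
   (\<And>\<omega>. \<omega> \<in> space N \<Longrightarrow> continuous_on {0..T} (\<lambda>s. X s \<omega>)) \<Longrightarrow> cont_process N T X"
  by (simp add: cont_process_def)

lemma cont_processD:
  assumes "cont_process N T X"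
  shows "0 \<le> s \<Longrightarrow> s \<le> T \<Longrightarrow> X s \<in> borel_measurable N"
    and "\<omega> \<in> space N \<Longrightarrow> continuous_on {0..T} (\<lambda>s. X s \<omega>)"
  using assms by (auto simp: cont_process_def)

lemma cont_process_mono: "cont_process N T X \<Longrightarrow> S \<le> T \<Longrightarrow> cont_process N S X"
  by (auto simp: cont_process_def intro: continuous_on_subset)

lemma cont_process_const: "f \<in> borel_measurable N \<Longrightarrow> cont_process N T (\<lambda>s. f)"
  by (auto simp: cont_process_def)

lemma cont_process_compose2:
  assumes "cont_process N T X" "cont_process N T Y"
    and f: "continuous_on UNIV (\<lambda>p :: real \<times> real. f (fst p) (snd p) :: real)"
  shows "cont_process N T (\<lambda>s \<omega>. f (X s \<omega>) (Y s \<omega>))"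
proof (rule cont_processI)
  fix s assume s: "0 \<le> s" "s \<le> T"
  have [measurable]: "X s \<in> borel_measurable N" "Y s \<in> borel_measurable N"
    using cont_processD(1)[OF assms(1) s] cont_processD(1)[OF assms(2) s] by auto
  have m: "(\<lambda>p :: real \<times> real. f (fst p) (snd p)) \<in> borel_measurable borel"
    by (rule borel_measurable_continuous_onI[OF f])
  have "(\<lambda>\<omega>. (X s \<omega>, Y s \<omega>)) \<in> measurable N (borel :: (real \<times> real) measure)"
    by (intro borel_measurable_Pair) simp_all
  from measurable_compose[OF this m] show "(\<lambda>\<omega>. f (X s \<omega>) (Y s \<omega>)) \<in> borel_measurable N"
    by simp
next
  fix \<omega> assume w: "\<omega> \<in> space N"
  have "continuous_on {0..T} (\<lambda>s. (X s \<omega>, Y s \<omega>))"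
    by (intro continuous_on_Pair cont_processD(2)[OF assms(1) w] cont_processD(2)[OF assms(2) w])
  from continuous_on_compose2[OF f this]
  show "continuous_on {0..T} (\<lambda>s. f (X s \<omega>) (Y s \<omega>))" by simp
qed

lemma cont_process_compose:
  assumes "cont_process N T X" "continuous_on UNIV (f :: real \<Rightarrow> real)"
  shows "cont_process N T (\<lambda>s \<omega>. f (X s \<omega>))"
  by (rule cont_process_compose2[OF assms(1) assms(1)])
     (auto intro!: continuous_on_compose2[OF assms(2)] continuous_intros)

lemma cont_process_diff: "cont_process N T X \<Longrightarrow> cont_process N T Y \<Longrightarrow> cont_process N T (\<lambda>s \<omega>. X s \<omega> - Y s \<omega>)"
  and cont_process_mult: "cont_process N T X \<Longrightarrow> cont_process N T Y \<Longrightarrow> cont_process N T (\<lambda>s \<omega>. X s \<omega> * Y s \<omega>)"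
  by (erule (1) cont_process_compose2, intro continuous_intros)+

text \<open>
  Times rounded down to a grid of mesh \<open>1 / (n + 1)\<close> and clamped to \<open>[0, T]\<close>. Sampling a process along
  the grid involves only countably many of its values, which makes the sampled process jointly
  measurable without any regularity of the paths; continuity is then used only to pass to the limit.
\<close>

definition grid :: "real \<Rightarrow> nat \<Rightarrow> real \<Rightarrow> real" where
  "grid T n s = max 0 (min T (real_of_int \<lfloor>real (Suc n) * s\<rfloor> / real (Suc n)))"

lemma grid_bounds: "0 \<le> T \<Longrightarrow> 0 \<le> grid T n s \<and> grid T n s \<le> T"
  by (auto simp: grid_def)

lemma grid_tendsto: "(\<lambda>n. grid T n s) \<longlonglongrightarrow> max 0 (min T s)"
proof -
  have "(\<lambda>n. real_of_int \<lfloor>real (Suc n) * s\<rfloor> / real (Suc n)) \<longlonglongrightarrow> s"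
  proof (rule tendsto_sandwich)
    show "\<forall>\<^sub>F n in sequentially. s - 1 / real (Suc n) \<le> real_of_int \<lfloor>real (Suc n) * s\<rfloor> / real (Suc n)"
    proof (intro always_eventually allI)
      fix n
      have "s - 1 / real (Suc n) = (real (Suc n) * s - 1) / real (Suc n)" by (simp add: field_simps)
      also have "\<dots> \<le> real_of_int \<lfloor>real (Suc n) * s\<rfloor> / real (Suc n)"
        by (intro divide_right_mono) linarith+
      finally show "s - 1 / real (Suc n) \<le> real_of_int \<lfloor>real (Suc n) * s\<rfloor> / real (Suc n)" .
    qed
    show "\<forall>\<^sub>F n in sequentially. real_of_int \<lfloor>real (Suc n) * s\<rfloor> / real (Suc n) \<le> s"
      by (intro always_eventually allI) (simp add: divide_le_eq mult.commute)
    have "(\<lambda>n. s - 1 / real (Suc n)) \<longlonglongrightarrow> s - 0"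
      by (intro tendsto_intros LIMSEQ_Suc[OF lim_1_over_n])
    then show "(\<lambda>n. s - 1 / real (Suc n)) \<longlonglongrightarrow> s" by simp
  qed simp
  then show ?thesis unfolding grid_def by (intro tendsto_intros)
qed

lemma grid_process_measurable:
  assumes X: "\<And>s. 0 \<le> s \<Longrightarrow> s \<le> T \<Longrightarrow> X s \<in> borel_measurable N" and T: "0 \<le> T"
  shows "(\<lambda>p. X (grid T n (fst p)) (snd p)) \<in> borel_measurable (lborel \<Otimes>\<^sub>M N)"
proof -
  define c where "c k = max 0 (min T (real_of_int k / real (Suc n)))" for k
  have "(\<lambda>p. (\<lambda>k p. X (c k) (snd p)) \<lfloor>real (Suc n) * fst p\<rfloor> p) \<in> borel_measurable (lborel \<Otimes>\<^sub>M N)"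
  proof (rule measurable_compose_countable[where f = "\<lambda>k p. X (c k) (snd p)"
        and g = "\<lambda>p. \<lfloor>real (Suc n) * fst p\<rfloor>"])
    fix k :: int
    have [measurable]: "X (c k) \<in> borel_measurable N" by (rule X) (use T in \<open>auto simp: c_def\<close>)
    show "(\<lambda>p. X (c k) (snd p)) \<in> borel_measurable (lborel \<Otimes>\<^sub>M N)" by measurable
  qed measurable
  then show ?thesis by (simp add: c_def grid_def)
qed

lemma cont_process_joint_measurable:
  assumes X: "cont_process N T X" and T: "0 \<le> T"
  shows "(\<lambda>(s, \<omega>). indicator {0..T} s * X s \<omega>) \<in> borel_measurable (lborel \<Otimes>\<^sub>M N)"
proof -
  have *: "(\<lambda>p. X (max 0 (min T (fst p))) (snd p)) \<in> borel_measurable (lborel \<Otimes>\<^sub>M N)"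
  proof (rule borel_measurable_LIMSEQ_real)
    fix p :: "real \<times> 'a" assume p: "p \<in> space (lborel \<Otimes>\<^sub>M N)"
    then have w: "snd p \<in> space N" by (auto simp: space_pair_measure)
    from continuous_on_tendsto_compose[OF cont_processD(2)[OF X w] grid_tendsto]
    show "(\<lambda>n. X (grid T n (fst p)) (snd p)) \<longlonglongrightarrow> X (max 0 (min T (fst p))) (snd p)"
      using T by (auto simp: grid_bounds)
  qed (rule grid_process_measurable[OF cont_processD(1)[OF X] T])
  have "(\<lambda>p. indicator {0..T} (fst p) * X (max 0 (min T (fst p))) (snd p)) \<in> borel_measurable (lborel \<Otimes>\<^sub>M N)"
    using * by measurable
  also have "(\<lambda>p. indicator {0..T} (fst p) * X (max 0 (min T (fst p))) (snd p)) = (\<lambda>(s, \<omega>). indicator {0..T} s * X s \<omega>)"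
    by (auto simp: fun_eq_iff indicator_def)
  finally show ?thesis .
qed

lemma cont_process_integral_measurable:
  assumes X: "cont_process N T X" and T: "0 \<le> T"
  shows "(\<lambda>\<omega>. LINT s:{0..T}|lborel. X s \<omega>) \<in> borel_measurable N"
proof -
  have "(\<lambda>(\<omega>, s). indicator {0..T} s * X s \<omega>) \<in> borel_measurable (N \<Otimes>\<^sub>M lborel)"
    using measurable_pair_swap[OF cont_process_joint_measurable[OF assms]] by (simp add: case_prod_beta)
  from lborel.borel_measurable_lebesgue_integral[OF this]
  show ?thesis by (simp add: set_lebesgue_integral_def)
qed

text \<open>
  For a fixed path the time integral is the integral of a continuous function, and the calculus for
  the Henstock-Kurzweil integral applies.
\<close>

lemma integral_path:
  assumes "continuous_on {0..T} (f :: real \<Rightarrow> real)" "s \<le> T"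
  shows "(LINT u:{0..s}|lborel. f u) = integral {0..s} f"
  by (rule set_borel_integral_eq_integral(2)[OF borel_integrable_atLeastAtMost'[OF continuous_on_subset[OF assms(1)]]])
     (use assms(2) in auto)

lemma integral_path_0:
  fixes f :: "real \<Rightarrow> real"
  shows "(LINT u:{0..0}|lborel. f u) = 0"
  unfolding set_lebesgue_integral_def
proof (rule integral_eq_zero_AE)
  show "AE u in lborel. indicator {0..0} u *\<^sub>R f u = 0"
    using AE_lborel_singleton[of 0] by eventually_elim (auto simp: indicator_def)
qed

lemma integral_path_deriv:
  assumes "continuous_on {0..T} (f :: real \<Rightarrow> real)" "s \<in> {0..T}"
  shows "((\<lambda>s. LINT u:{0..s}|lborel. f u) has_real_derivative f s) (at s within {0..T})"
  using integral_has_real_derivative[OF assms] unfolding has_field_derivative_def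
  by (rule has_derivative_transform[OF assms(2), rotated]) (auto intro!: integral_path[OF assms(1)])

lemma integral_path_continuous:
  assumes "continuous_on {0..T} (f :: real \<Rightarrow> real)"
  shows "continuous_on {0..T} (\<lambda>s. LINT u:{0..s}|lborel. f u)"
  using integral_path_deriv[OF assms] DERIV_continuous_on by blast

lemma integral_path_FTC:
  assumes T: "0 \<le> T" and f: "continuous_on {0..T} (f :: real \<Rightarrow> real)"
    and d: "\<And>s. s \<in> {0..T} \<Longrightarrow> (F has_real_derivative f s) (at s within {0..T})"
  shows "(LINT u:{0..T}|lborel. f u) = F T - F 0"
proof -
  have "(f has_integral (F T - F 0)) {0..T}"
    by (rule fundamental_theorem_of_calculus[OF T]) (use d in \<open>auto simp: has_real_derivative_iff_has_vector_derivative\<close>)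
  then show ?thesis using integral_path[OF f, of T] by (simp add: integral_unique)
qed

lemma integral_path_mono:
  assumes "continuous_on {0..T} (f :: real \<Rightarrow> real)" "continuous_on {0..T} (g :: real \<Rightarrow> real)"
    "\<And>s. s \<in> {0..T} \<Longrightarrow> f s \<le> g s"
  shows "(LINT u:{0..T}|lborel. f u) \<le> (LINT u:{0..T}|lborel. g u)"
  by (intro set_integral_mono borel_integrable_atLeastAtMost' assms)

lemma cont_process_integral:
  assumes X: "cont_process N T X"
  shows "cont_process N T (\<lambda>t \<omega>. LINT s:{0..t}|lborel. X s \<omega>)"
  by (intro cont_processI cont_process_integral_measurable cont_process_mono[OF X] integral_path_continuous cont_processD(2)[OF X])


section \<open>Expectations of exponential functionals\<close>

text \<open>
  The bound \<open>K\<close> is on the pathwise integral only. The integrand itself may be unbounded in \<open>\<omega>\<close>, as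
  it is for the killing rate \<open>exp(2u)\<close>; its value at a fixed time is then integrable only for almost
  every time.
\<close>

lemma (in prob_space) cont_process_Fubini:
  assumes X: "cont_process M T X" and T: "0 \<le> T"
    and K: "\<And>\<omega>. \<omega> \<in> space M \<Longrightarrow> (LINT s:{0..T}|lborel. \<bar>X s \<omega>\<bar>) \<le> K"
  shows "integrable M (\<lambda>\<omega>. LINT s:{0..T}|lborel. X s \<omega>)"
    and "AE s in lborel. s \<in> {0..T} \<longrightarrow> integrable M (X s)"
    and "expectation (\<lambda>\<omega>. LINT s:{0..T}|lborel. X s \<omega>) = (LINT s:{0..T}|lborel. expectation (X s))"
proof -
  interpret P: pair_sigma_finite M "lborel :: real measure" ..
  have m: "(\<lambda>(\<omega>, s). indicator {0..T} s * X s \<omega>) \<in> borel_measurable (M \<Otimes>\<^sub>M lborel)"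
    using measurable_pair_swap[OF cont_process_joint_measurable[OF X T]] by (simp add: case_prod_beta)
  have path: "set_integrable lborel {0..T} (\<lambda>s. X s \<omega>)" if "\<omega> \<in> space M" for \<omega>
    by (rule borel_integrable_atLeastAtMost'[OF cont_processD(2)[OF X that]])
  have abs: "(\<integral>s. norm (indicator {0..T} s * X s \<omega>) \<partial>lborel) = (LINT s:{0..T}|lborel. \<bar>X s \<omega>\<bar>)" for \<omega>
    unfolding set_lebesgue_integral_def
    by (rule Bochner_Integration.integral_cong) (auto simp: indicator_def)
  have nn: "0 \<le> (LINT s:{0..T}|lborel. \<bar>X s \<omega>\<bar>)" for \<omega>
    unfolding set_lebesgue_integral_def by (intro integral_nonneg_AE AE_I2) auto
  have i: "integrable (M \<Otimes>\<^sub>M lborel) (\<lambda>(\<omega>, s). indicator {0..T} s * X s \<omega>)"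
  proof (rule P.Fubini_integrable[OF m])
    show "integrable M (\<lambda>x. \<integral>y. norm (case (x, y) of (\<omega>, s) \<Rightarrow> indicator {0..T} s * X s \<omega>) \<partial>lborel)"
    proof (rule integrable_const_bound[where B = K])
      show "AE x in M. norm (\<integral>y. norm (case (x, y) of (\<omega>, s) \<Rightarrow> indicator {0..T} s * X s \<omega>) \<partial>lborel) \<le> K"
        by (rule AE_I2) (use K nn in \<open>simp add: abs[unfolded real_norm_def]\<close>)
      show "(\<lambda>x. \<integral>y. norm (case (x, y) of (\<omega>, s) \<Rightarrow> indicator {0..T} s * X s \<omega>) \<partial>lborel) \<in> borel_measurable M"
        by (rule lborel.borel_measurable_lebesgue_integral) (use m in \<open>auto simp: case_prod_beta\<close>)
    qed
    show "AE x in M. integrable lborel (\<lambda>y. case (x, y) of (\<omega>, s) \<Rightarrow> indicator {0..T} s * X s \<omega>)"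
      by (rule AE_I2) (use path in \<open>simp add: set_integrable_def\<close>)
  qed
  show "integrable M (\<lambda>\<omega>. LINT s:{0..T}|lborel. X s \<omega>)"
    using P.integrable_fst[OF i] by (simp add: set_lebesgue_integral_def)
  show "AE s in lborel. s \<in> {0..T} \<longrightarrow> integrable M (X s)"
    using P.AE_integrable_snd[OF i] by eventually_elim auto
  show "expectation (\<lambda>\<omega>. LINT s:{0..T}|lborel. X s \<omega>) = (LINT s:{0..T}|lborel. expectation (X s))"
    using P.Fubini_integral[OF i] by (simp add: set_lebesgue_integral_def)
qed

lemma (in prob_space) martingale_times_adapted:
  assumes mart: "martingale M F N" and sub: "\<And>s. subalgebra M (F s)"
    and s: "0 \<le> s" "s \<le> t"
    and bd: "\<And>\<omega>. \<omega> \<in> space M \<Longrightarrow> \<bar>N t \<omega>\<bar> \<le> C"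
    and Z: "Z \<in> borel_measurable (F s)" "integrable M Z"
  shows "expectation (\<lambda>\<omega>. N t \<omega> * Z \<omega>) = expectation (\<lambda>\<omega>. N s \<omega> * Z \<omega>)"
proof -
  interpret f: finite_measure_subalgebra M "F s"
    using sub[of s] by unfold_locales
  have [measurable]: "N t \<in> borel_measurable M"
    using mart s unfolding martingale_def by (meson borel_measurable_integrable order_trans)
  have Ns: "N s \<in> borel_measurable M"
    using mart s unfolding martingale_def by (meson borel_measurable_integrable order_trans)
  have int: "integrable M (\<lambda>\<omega>. Z \<omega> * N t \<omega>)"
  proof (rule Bochner_Integration.integrable_bound[OF integrable_mult_left[OF Z(2), of C]])
    show "AE x in M. norm (Z x * N t x) \<le> norm (Z x * C)"
      by (rule AE_I2) (use bd in \<open>fastforce simp: abs_mult intro!: mult_left_mono\<close>)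
  qed (use borel_measurable_integrable[OF Z(2)] in measurable)
  have "expectation (\<lambda>\<omega>. N t \<omega> * Z \<omega>) = expectation (\<lambda>\<omega>. Z \<omega> * N t \<omega>)"
    by (simp add: mult.commute)
  also have "\<dots> = expectation (\<lambda>\<omega>. Z \<omega> * real_cond_exp M (F s) (N t) \<omega>)"
    by (rule f.real_cond_exp_intg(2)[symmetric, OF int Z(1)]) measurable
  also have "\<dots> = expectation (\<lambda>\<omega>. N s \<omega> * Z \<omega>)"
  proof (rule integral_cong_AE)
    have "AE \<omega> in M. real_cond_exp M (F s) (N t) \<omega> = N s \<omega>"
      using mart s unfolding martingale_def by blast
    then show "AE \<omega> in M. Z \<omega> * real_cond_exp M (F s) (N t) \<omega> = N s \<omega> * Z \<omega>"
      by eventually_elim simp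
  qed (use borel_measurable_integrable[OF Z(2)] Ns in measurable)
  finally show ?thesis .
qed

text \<open>
  This is \<open>E[N\<^sub>T V\<^sub>T] = E \<integral>\<^sub>0\<^sup>T N\<^sub>s dV\<^sub>s\<close> for a bounded martingale \<open>N\<close> and \<open>dV = Z ds\<close>: exchange
  expectation and time integral, and replace \<open>N\<^sub>T\<close> by \<open>N\<^sub>s\<close> in the product with the adapted \<open>Z\<^sub>s\<close>.
\<close>

lemma (in prob_space) martingale_integration_by_parts:
  assumes mart: "martingale M F N" and sub: "\<And>s. subalgebra M (F s)" and T: "0 \<le> T"
    and N: "cont_process M T N" and bd: "\<And>s \<omega>. \<omega> \<in> space M \<Longrightarrow> s \<in> {0..T} \<Longrightarrow> \<bar>N s \<omega>\<bar> \<le> C"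
    and Z: "cont_process M T Z" and ad: "\<And>s. s \<in> {0..T} \<Longrightarrow> Z s \<in> borel_measurable (F s)"
    and K: "\<And>\<omega>. \<omega> \<in> space M \<Longrightarrow> (LINT s:{0..T}|lborel. \<bar>Z s \<omega>\<bar>) \<le> K"
  shows "integrable M (\<lambda>\<omega>. N T \<omega> * (LINT s:{0..T}|lborel. Z s \<omega>))"
    and "integrable M (\<lambda>\<omega>. LINT s:{0..T}|lborel. N s \<omega> * Z s \<omega>)"
    and "expectation (\<lambda>\<omega>. N T \<omega> * (LINT s:{0..T}|lborel. Z s \<omega>)) =
    expectation (\<lambda>\<omega>. LINT s:{0..T}|lborel. N s \<omega> * Z s \<omega>)"
proof -
  have NT: "cont_process M T (\<lambda>s. N T)" by (intro cont_process_const cont_processD(1)[OF N]) (use T in auto)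
  have bound: "(LINT s:{0..T}|lborel. \<bar>Y s \<omega> * Z s \<omega>\<bar>) \<le> \<bar>C\<bar> * K"
    if Y: "cont_process M T Y" and b: "\<And>s. s \<in> {0..T} \<Longrightarrow> \<bar>Y s \<omega>\<bar> \<le> C" and w: "\<omega> \<in> space M" for Y \<omega>
  proof -
    have "(LINT s:{0..T}|lborel. \<bar>Y s \<omega> * Z s \<omega>\<bar>) \<le> (LINT s:{0..T}|lborel. \<bar>C\<bar> * \<bar>Z s \<omega>\<bar>)"
      by (rule integral_path_mono)
         (use cont_processD(2)[OF Y w] cont_processD(2)[OF Z w] b in
           \<open>fastforce intro!: continuous_intros mult_right_mono simp: abs_mult\<close>)+
    also have "\<dots> = \<bar>C\<bar> * (LINT s:{0..T}|lborel. \<bar>Z s \<omega>\<bar>)" by simp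
    also have "\<dots> \<le> \<bar>C\<bar> * K" by (rule mult_left_mono[OF K[OF w]]) simp
    finally show ?thesis .
  qed
  show "integrable M (\<lambda>\<omega>. N T \<omega> * (LINT s:{0..T}|lborel. Z s \<omega>))"
    using cont_process_Fubini(1)[OF cont_process_mult[OF NT Z] T bound[OF NT]] bd T by simp
  show "integrable M (\<lambda>\<omega>. LINT s:{0..T}|lborel. N s \<omega> * Z s \<omega>)"
    by (rule cont_process_Fubini(1)[OF cont_process_mult[OF N Z] T bound[OF N]]) (use bd in auto)
  have ae: "AE s in lborel. s \<in> {0..T} \<longrightarrow> integrable M (Z s)"
    by (rule cont_process_Fubini(2)[OF Z T K])
  have "expectation (\<lambda>\<omega>. N T \<omega> * (LINT s:{0..T}|lborel. Z s \<omega>)) =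
      expectation (\<lambda>\<omega>. LINT s:{0..T}|lborel. N T \<omega> * Z s \<omega>)" by simp
  also have "\<dots> = (LINT s:{0..T}|lborel. expectation (\<lambda>\<omega>. N T \<omega> * Z s \<omega>))"
    by (rule cont_process_Fubini(3)[OF cont_process_mult[OF NT Z] T bound[OF NT]]) (use bd T in auto)
  also have "\<dots> = (LINT s:{0..T}|lborel. expectation (\<lambda>\<omega>. N s \<omega> * Z s \<omega>))"
    unfolding set_lebesgue_integral_def
  proof (rule integral_cong_AE)
    have "(\<lambda>(s, \<omega>). indicator {0..T} s * (Y s \<omega> * Z s \<omega>)) \<in> borel_measurable (lborel \<Otimes>\<^sub>M M)"
      if "cont_process M T Y" for Y
      using cont_process_joint_measurable[OF cont_process_mult[OF that Z] T] .
    from borel_measurable_lebesgue_integral[OF this]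
    have m: "(\<lambda>s. indicator {0..T} s *\<^sub>R expectation (\<lambda>\<omega>. Y s \<omega> * Z s \<omega>)) \<in> borel_measurable lborel"
      if "cont_process M T Y" for Y using that by simp
    show "(\<lambda>s. indicator {0..T} s *\<^sub>R expectation (\<lambda>\<omega>. N T \<omega> * Z s \<omega>)) \<in> borel_measurable lborel"
         "(\<lambda>s. indicator {0..T} s *\<^sub>R expectation (\<lambda>\<omega>. N s \<omega> * Z s \<omega>)) \<in> borel_measurable lborel"
      by (rule m[OF NT], rule m[OF N])
    show "AE s in lborel. indicator {0..T} s *\<^sub>R expectation (\<lambda>\<omega>. N T \<omega> * Z s \<omega>) =
        indicator {0..T} s *\<^sub>R expectation (\<lambda>\<omega>. N s \<omega> * Z s \<omega>)"
      using ae
    proof eventually_elim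
      case (elim s)
      then show ?case
        using martingale_times_adapted[OF mart sub, of s T C "Z s"] bd ad T by (auto simp: indicator_def)
    qed
  qed
  also have "\<dots> = expectation (\<lambda>\<omega>. LINT s:{0..T}|lborel. N s \<omega> * Z s \<omega>)"
    by (rule cont_process_Fubini(3)[symmetric, OF cont_process_mult[OF N Z] T bound[OF N]]) (use bd in auto)
  finally show "expectation (\<lambda>\<omega>. N T \<omega> * (LINT s:{0..T}|lborel. Z s \<omega>)) =
    expectation (\<lambda>\<omega>. LINT s:{0..T}|lborel. N s \<omega> * Z s \<omega>)" .
qed

text \<open>
  Think of \<open>Y\<^sub>s = f(X\<^sub>s)\<close>, \<open>h\<^sub>s = L f(X\<^sub>s)\<close> and of \<open>- W\<close> as a killing rate. With the martingale
  \<open>N = Y - Y\<^sub>0 - H\<close>, \<open>H = \<integral> h\<close>, and \<open>dG = W G ds\<close>, the product rule for \<open>G H\<close> and integration by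
  parts for \<open>G N\<close> give the formula. Only an upper bound on \<open>W\<close> is available in the application; it
  suffices because \<open>\<bar>W\<bar> \<le> 2 \<kappa> - W\<close> and \<open>\<integral> W G = G\<^sub>T - 1\<close>, which bounds \<open>\<integral> \<bar>W\<bar> G\<close>.
\<close>

lemma (in prob_space) Feynman_Kac:
  fixes W :: "real \<Rightarrow> 'a \<Rightarrow> real" and \<kappa> :: real
  defines "G \<equiv> \<lambda>s \<omega>. exp (LINT u:{0..s}|lborel. W u \<omega>)"
  assumes sub: "\<And>s. subalgebra M (F s)" and T: "0 \<le> T"
    and Y: "cont_process M T Y" and CY: "\<And>s \<omega>. \<omega> \<in> space M \<Longrightarrow> s \<in> {0..T} \<Longrightarrow> \<bar>Y s \<omega>\<bar> \<le> CY"
    and h: "cont_process M T h" and Ch: "\<And>s \<omega>. \<omega> \<in> space M \<Longrightarrow> s \<in> {0..T} \<Longrightarrow> \<bar>h s \<omega>\<bar> \<le> Ch"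
    and mart: "martingale M F (\<lambda>t \<omega>. Y t \<omega> - Y 0 \<omega> - (LINT s:{0..t}|lborel. h s \<omega>))"
    and W: "cont_process M T W" and adW: "\<And>s. s \<in> {0..T} \<Longrightarrow> cont_process (F s) s W"
    and kap: "0 \<le> \<kappa>" "\<And>s \<omega>. \<omega> \<in> space M \<Longrightarrow> s \<in> {0..T} \<Longrightarrow> W s \<omega> \<le> \<kappa>"
    and Y0: "AE \<omega> in M. Y 0 \<omega> = y0"
  shows "expectation (\<lambda>\<omega>. G T \<omega> * Y T \<omega>) =
      y0 + expectation (\<lambda>\<omega>. LINT s:{0..T}|lborel. G s \<omega> * (h s \<omega> + W s \<omega> * Y s \<omega>))"
    and "integrable M (\<lambda>\<omega>. LINT s:{0..T}|lborel. G s \<omega> * (h s \<omega> + W s \<omega> * Y s \<omega>))"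
proof -
  define H where "H t \<omega> = (LINT s:{0..t}|lborel. h s \<omega>)" for t \<omega>
  define N where "N t \<omega> = Y t \<omega> - Y 0 \<omega> - H t \<omega>" for t \<omega>
  define Z where "Z s \<omega> = W s \<omega> * G s \<omega>" for s \<omega>
  define I where "I \<omega> = (LINT s:{0..T}|lborel. G s \<omega> * (h s \<omega> + W s \<omega> * Y s \<omega>))" for \<omega>
  have T0: "0 \<in> {0..T}" "T \<in> {0..T}" using T by auto
  have G: "cont_process M T G" unfolding G_def by (intro cont_process_compose[OF cont_process_integral[OF W]] continuous_intros)
  have H: "cont_process M T H" unfolding H_def by (rule cont_process_integral[OF h])
  have Y0m: "cont_process M T (\<lambda>s. Y 0)" by (intro cont_process_const cont_processD(1)[OF Y]) (use T in auto)
  have N: "cont_process M T N" unfolding N_def by (intro cont_process_diff Y H Y0m)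
  have Z: "cont_process M T Z" unfolding Z_def by (intro cont_process_mult W G)
  have Zad: "Z s \<in> borel_measurable (F s)" if "s \<in> {0..T}" for s
  proof -
    have "cont_process (F s) s (\<lambda>s \<omega>. W s \<omega> * G s \<omega>)" unfolding G_def
      by (intro cont_process_mult adW[OF that] cont_process_compose[OF cont_process_integral[OF adW[OF that]]] continuous_intros)
    from cont_processD(1)[OF this, of s] that show ?thesis by (simp add: Z_def[abs_def])
  qed
  have dG: "((\<lambda>s. G s \<omega>) has_real_derivative Z s \<omega>) (at s within {0..T})" if "\<omega> \<in> space M" "s \<in> {0..T}" for s \<omega>
    unfolding G_def Z_def
    by (rule derivative_eq_intros integral_path_deriv[OF cont_processD(2)[OF W that(1)] that(2)] refl)+ simp
  have dH: "((\<lambda>s. H s \<omega>) has_real_derivative h s \<omega>) (at s within {0..T})" if "\<omega> \<in> space M" "s \<in> {0..T}" for s \<omega>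
    unfolding H_def by (rule integral_path_deriv[OF cont_processD(2)[OF h that(1)] that(2)])
  have GT: "(LINT s:{0..T}|lborel. Z s \<omega>) = G T \<omega> - 1" if w: "\<omega> \<in> space M" for \<omega>
    using integral_path_FTC[OF T cont_processD(2)[OF Z w] dG[OF w]] by (simp add: G_def integral_path_0 del: atLeastAtMost_singleton)
  have Gb: "G s \<omega> \<le> exp (\<kappa> * T)" if w: "\<omega> \<in> space M" and s: "s \<in> {0..T}" for s \<omega>
  proof -
    have "(LINT u:{0..s}|lborel. W u \<omega>) \<le> (LINT u:{0..s}|lborel. \<kappa>)"
      by (intro integral_path_mono cont_processD(2)[OF cont_process_mono[OF W] w] kap(2)[OF w]) (use s in auto)
    also have "\<dots> = \<kappa> * s" using s by (simp add: set_integral_const)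
    also have "\<dots> \<le> \<kappa> * T" using s kap(1) by (intro mult_left_mono) auto
    finally show ?thesis by (simp add: G_def)
  qed
  have K: "(LINT s:{0..T}|lborel. \<bar>Z s \<omega>\<bar>) \<le> 2 * \<kappa> * exp (\<kappa> * T) * T + 1" if w: "\<omega> \<in> space M" for \<omega>
  proof -
    note cont = cont_processD(2)[OF Z w]
    have "(LINT s:{0..T}|lborel. \<bar>Z s \<omega>\<bar>) \<le> (LINT s:{0..T}|lborel. 2 * \<kappa> * exp (\<kappa> * T) - Z s \<omega>)"
    proof (intro integral_path_mono continuous_intros cont)
      fix s assume s: "s \<in> {0..T}"
      have "\<bar>W s \<omega>\<bar> + W s \<omega> \<le> 2 * \<kappa>" using kap(2)[OF w s] kap(1) by auto
      then have "(\<bar>W s \<omega>\<bar> + W s \<omega>) * G s \<omega> \<le> 2 * \<kappa> * exp (\<kappa> * T)"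
        by (rule mult_mono[OF _ Gb[OF w s]]) (use kap(1) in \<open>auto simp: G_def\<close>)
      then show "\<bar>Z s \<omega>\<bar> \<le> 2 * \<kappa> * exp (\<kappa> * T) - Z s \<omega>"
        by (simp add: Z_def abs_mult G_def algebra_simps)
    qed
    also have "\<dots> = (LINT s:{0..T}|lborel. 2 * \<kappa> * exp (\<kappa> * T)) - (LINT s:{0..T}|lborel. Z s \<omega>)"
      by (intro set_integral_diff borel_integrable_atLeastAtMost' cont continuous_intros)
    also have "\<dots> \<le> 2 * \<kappa> * exp (\<kappa> * T) * T + 1"
      using T by (simp add: GT[OF w] set_integral_const G_def)
    finally show ?thesis .
  qed
  have CN: "\<bar>N s \<omega>\<bar> \<le> CY + CY + Ch * T" if w: "\<omega> \<in> space M" and s: "s \<in> {0..T}" for s \<omega>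
  proof -
    have Ch0: "0 \<le> Ch" using Ch[OF w s] by simp
    have hs: "continuous_on {0..s} (\<lambda>s. h s \<omega>)" by (rule cont_processD(2)[OF cont_process_mono[OF h] w]) (use s in auto)
    have "\<bar>H s \<omega>\<bar> \<le> (LINT u:{0..s}|lborel. \<bar>h u \<omega>\<bar>)"
      unfolding H_def set_lebesgue_integral_def
      by (rule order_trans[OF integral_abs_bound]) (simp add: abs_mult)
    also have "\<dots> \<le> (LINT u:{0..s}|lborel. Ch)"
      by (intro integral_path_mono continuous_intros hs Ch w) (use s in auto)
    also have "\<dots> = Ch * s" using s by (simp add: set_integral_const)
    also have "\<dots> \<le> Ch * T" using s Ch0 by (intro mult_left_mono) auto
    finally show ?thesis using CY[OF w s] CY[OF w T0(1)] by (auto simp: N_def)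
  qed
  have mN: "martingale M F N" using mart unfolding N_def H_def .
  note ibp = martingale_integration_by_parts[OF mN sub T N CN Z Zad K]
  have NT: "integrable M (N T)"
    using cont_processD(1)[OF N, of T] T CN[OF _ T0(2)] by (intro integrable_const_bound[where B = "CY + CY + Ch * T"]) auto
  have YT: "integrable M (\<lambda>\<omega>. G T \<omega> * Y T \<omega>)"
  proof (rule integrable_const_bound[where B = "exp (\<kappa> * T) * CY"])
    show "AE x in M. norm (G T x * Y T x) \<le> exp (\<kappa> * T) * CY"
      by (rule AE_I2) (use Gb[OF _ T0(2)] CY[OF _ T0(2)] in
        \<open>auto simp: abs_mult G_def intro!: mult_mono\<close>)
  qed (use cont_processD(1)[OF cont_process_mult[OF G Y], of T] T in auto)
  have Y0i: "integrable M (Y 0)"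
    using cont_processD(1)[OF Y, of 0] T CY[OF _ T0(1)] by (intro integrable_const_bound[where B = CY]) auto
  \<comment> \<open>pathwise, the product rule for \<open>G H\<close>; what is left over involves \<open>N\<close> only\<close>
  have path: "I \<omega> = G T \<omega> * Y T \<omega> - N T \<omega> - N T \<omega> * (LINT s:{0..T}|lborel. Z s \<omega>) - Y 0 \<omega>
      + (LINT s:{0..T}|lborel. N s \<omega> * Z s \<omega>)" if w: "\<omega> \<in> space M" for \<omega>
  proof -
    note c = cont_processD(2)[OF Z w] cont_processD(2)[OF G w] cont_processD(2)[OF h w] cont_processD(2)[OF H w] cont_processD(2)[OF N w]
    have "I \<omega> = (LINT s:{0..T}|lborel. Y 0 \<omega> * Z s \<omega> + (Z s \<omega> * H s \<omega> + G s \<omega> * h s \<omega>) + N s \<omega> * Z s \<omega>)"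
      unfolding I_def by (rule arg_cong[where f = "set_lebesgue_integral _ _"])
        (auto simp: fun_eq_iff N_def Z_def algebra_simps)
    also have "\<dots> = (LINT s:{0..T}|lborel. Y 0 \<omega> * Z s \<omega>) + (LINT s:{0..T}|lborel. Z s \<omega> * H s \<omega> + G s \<omega> * h s \<omega>)
        + (LINT s:{0..T}|lborel. N s \<omega> * Z s \<omega>)"
      by (subst set_integral_add, (intro borel_integrable_atLeastAtMost' continuous_intros c)+)
         (subst set_integral_add, (intro borel_integrable_atLeastAtMost' continuous_intros c)+, simp)
    also have "(LINT s:{0..T}|lborel. Z s \<omega> * H s \<omega> + G s \<omega> * h s \<omega>) = G T \<omega> * H T \<omega> - G 0 \<omega> * H 0 \<omega>"
      by (rule integral_path_FTC[OF T, of _ "\<lambda>s. G s \<omega> * H s \<omega>"])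
         (intro continuous_intros c, rule DERIV_cong[OF DERIV_mult[OF dG[OF w] dH[OF w]]], simp_all)
    finally show ?thesis
      by (simp add: GT[OF w] N_def H_def algebra_simps integral_path_0 del: atLeastAtMost_singleton)
  qed
  have Ii: "integrable M I"
    by (subst Bochner_Integration.integrable_cong[OF refl path])
       (simp, intro Bochner_Integration.integrable_add Bochner_Integration.integrable_diff YT NT ibp(1,2) Y0i)
  have EN: "expectation (N T) = 0"
  proof -
    have "expectation (\<lambda>\<omega>. N T \<omega> * 1) = expectation (\<lambda>\<omega>. N 0 \<omega> * 1)"
      by (rule martingale_times_adapted[OF mN sub _ T CN[OF _ T0(2)]]) auto
    then show ?thesis by (simp add: N_def[abs_def] H_def integral_path_0 del: atLeastAtMost_singleton)
  qed
  have "expectation (Y 0) = expectation (\<lambda>\<omega>. y0)"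
    using Y0 cont_processD(1)[OF Y, of 0] T by (intro integral_cong_AE) auto
  then have EY: "expectation (Y 0) = y0" by (simp add: prob_space)
  have "expectation I = expectation (\<lambda>\<omega>. G T \<omega> * Y T \<omega>) - y0"
    using ibp(3) EN EY YT NT ibp(1,2) Y0i
    by (subst Bochner_Integration.integral_cong[OF refl path]) simp_all
  then show "expectation (\<lambda>\<omega>. G T \<omega> * Y T \<omega>) =
      y0 + expectation (\<lambda>\<omega>. LINT s:{0..T}|lborel. G s \<omega> * (h s \<omega> + W s \<omega> * Y s \<omega>))"
    unfolding I_def by simp
  show "integrable M (\<lambda>\<omega>. LINT s:{0..T}|lborel. G s \<omega> * (h s \<omega> + W s \<omega> * Y s \<omega>))"
    using Ii unfolding I_def .
qed


section \<open>Test functions for the Jacobi generator\<close>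

text \<open>
  Compact support in \<open>I\<close> leaves a margin: every point lies in one of the open sets \<open>I\<close> and \<open>- K\<close>, and
  the extended function is smooth on both.
\<close>

lemma zero_extension_has_derivative:
  fixes g g1 :: "real \<Rightarrow> real"
  assumes "open I" "compact K" "K \<subseteq> I"
    and d: "\<And>x. x \<in> I \<Longrightarrow> (g has_real_derivative g1 x) (at x)"
    and z: "\<And>x. x \<in> I - K \<Longrightarrow> g x = 0" "\<And>x. x \<in> I - K \<Longrightarrow> g1 x = 0"
  shows "((\<lambda>x. if x \<in> I then g x else 0) has_real_derivative (if x \<in> I then g1 x else 0)) (at x)"
proof (cases "x \<in> I")
  case True
  have "((\<lambda>x. if x \<in> I then g x else 0) has_real_derivative g1 x) (at x)"
    by (rule has_field_derivative_transform_within_open[OF d[OF True] \<open>open I\<close> True]) simp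
  with True show ?thesis by simp
next
  case False
  have "open (- K)" using \<open>compact K\<close> by (simp add: compact_imp_closed open_Compl)
  moreover have "x \<in> - K" using False \<open>K \<subseteq> I\<close> by auto
  ultimately have "((\<lambda>x. if x \<in> I then g x else 0) has_real_derivative 0) (at x)"
    by (rule has_field_derivative_transform_within_open[OF DERIV_const[of 0]]) (use z(1) in auto)
  with False show ?thesis by simp
qed

lemma C2_compact_support_zero_extension:
  fixes f f1 f2 :: "real \<Rightarrow> real"
  assumes I: "open I" "compact K" "K \<subseteq> I"
    and d1: "\<And>x. x \<in> I \<Longrightarrow> (f has_real_derivative f1 x) (at x)"
    and d2: "\<And>x. x \<in> I \<Longrightarrow> (f1 has_real_derivative f2 x) (at x)"
    and c: "continuous_on I f2"
    and z: "\<And>x. x \<in> I - K \<Longrightarrow> f x = 0" "\<And>x. x \<in> I - K \<Longrightarrow> f1 x = 0" "\<And>x. x \<in> I - K \<Longrightarrow> f2 x = 0"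
  defines "F \<equiv> \<lambda>x. if x \<in> I then f x else 0"
  shows "C2_compact_support I F"
    and "x \<in> I \<Longrightarrow> deriv F x = f1 x"
    and "x \<in> I \<Longrightarrow> deriv (deriv F) x = f2 x"
proof -
  have D1: "(F has_real_derivative (if x \<in> I then f1 x else 0)) (at x)" for x
    unfolding F_def by (rule zero_extension_has_derivative[OF I d1 z(1,2)])
  have e1: "deriv F = (\<lambda>x. if x \<in> I then f1 x else 0)"
    using DERIV_imp_deriv[OF D1] by auto
  have D2: "(deriv F has_real_derivative (if x \<in> I then f2 x else 0)) (at x)" for x
    unfolding e1 by (rule zero_extension_has_derivative[OF I d2 z(2,3)])
  have e2: "deriv (deriv F) = (\<lambda>x. if x \<in> I then f2 x else 0)"
    using DERIV_imp_deriv[OF D2] by auto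
  have oK: "open (- K)" using I(2) by (simp add: compact_imp_closed open_Compl)
  have "continuous_on (I \<union> - K) (\<lambda>x. if x \<in> I then f2 x else 0)"
  proof (rule continuous_on_open_Un[OF I(1) oK])
    show "continuous_on I (\<lambda>x. if x \<in> I then f2 x else 0)" using c by (simp cong: continuous_on_cong)
    have "continuous_on (- K) (\<lambda>x. 0 :: real)" by simp
    then show "continuous_on (- K) (\<lambda>x. if x \<in> I then f2 x else 0)"
      by (rule continuous_on_eq) (use z(3) in auto)
  qed
  moreover have "I \<union> - K = UNIV" using I(3) by auto
  ultimately have cont: "continuous_on UNIV (deriv (deriv F))" unfolding e2 by simp
  have "\<forall>x. x \<notin> K \<longrightarrow> F x = 0" using z(1) by (auto simp: F_def)
  then show "C2_compact_support I F"
    unfolding C2_compact_support_def field_differentiable_def using D1 D2 cont I(2,3) by blast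
  show "x \<in> I \<Longrightarrow> deriv F x = f1 x" "x \<in> I \<Longrightarrow> deriv (deriv F) x = f2 x"
    by (simp_all add: e2, simp add: e1)
qed

lemma sin_2_pos: "r \<in> {0<..<pi/2} \<Longrightarrow> 0 < sin (2 * r)"
  by (rule sin_gt_zero) auto

text \<open>
  In the coordinate \<open>u = - ln (sin (2 r))\<close> the half-line \<open>u \<ge> 0\<close> covers the state space twice, both
  poles are at \<open>u = \<infinity>\<close>, and \<open>u' = - 2 cot (2r)\<close>, \<open>u'' = 4 / sin\<^sup>2 (2r)\<close>, \<open>cot\<^sup>2 (2r) = exp (2u) - 1\<close>.
  The generator thus becomes \<open>2 \<psi>' + 2 (exp (2u) - 1) \<psi>''\<close>, and functions vanishing for large \<open>u\<close>
  have compact support in the open interval.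
\<close>

lemma jacobi_generator_log_sin:
  fixes \<psi> \<psi>1 \<psi>2 :: "real \<Rightarrow> real"
  assumes d1: "\<And>u. (\<psi> has_real_derivative \<psi>1 u) (at u)"
    and d2: "\<And>u. (\<psi>1 has_real_derivative \<psi>2 u) (at u)"
    and c: "continuous_on UNIV \<psi>2"
    and z: "\<And>u. R \<le> u \<Longrightarrow> \<psi> u = 0" "\<And>u. R \<le> u \<Longrightarrow> \<psi>1 u = 0" "\<And>u. R \<le> u \<Longrightarrow> \<psi>2 u = 0"
  shows "\<exists>f. C2_compact_support {0<..<pi/2} f \<and> (\<forall>r\<in>{0<..<pi/2}. let u = - ln (sin (2 * r)) in
    f r = \<psi> u \<and> jacobi_generator f r = 2 * \<psi>1 u + 2 * (exp (2 * u) - 1) * \<psi>2 u)"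
proof -
  define I :: "real set" where "I = {0<..<pi/2}"
  \<comment> \<open>the points at which \<open>u \<le> R\<close>\<close>
  define K where "K = {0..pi/2} \<inter> {r. exp (- R) \<le> sin (2 * r)}"
  define u where "u r = - ln (sin (2 * r))" for r :: real
  define f where "f r = \<psi> (u r)" for r
  define f1 where "f1 r = - 2 * (cos (2 * r) / sin (2 * r)) * \<psi>1 (u r)" for r
  define f2 where "f2 r = 4 / (sin (2 * r))\<^sup>2 * \<psi>1 (u r) + 4 * (cos (2 * r))\<^sup>2 / (sin (2 * r))\<^sup>2 * \<psi>2 (u r)" for r
  define F where "F r = (if r \<in> I then f r else 0)" for r
  have pos: "0 < sin (2 * r)" if "r \<in> I" for r using sin_2_pos that by (simp add: I_def)
  have o: "open I" by (simp add: I_def)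
  have "closed {r. exp (- R) \<le> sin (2 * r)}" by (intro closed_Collect_le continuous_intros)
  then have K: "compact K" unfolding K_def by (intro compact_Int_closed) simp_all
  have KI: "K \<subseteq> I"
  proof
    fix r assume "r \<in> K"
    then have r: "0 \<le> r" "r \<le> pi/2" "exp (- R) \<le> sin (2 * r)" by (auto simp: K_def)
    have "sin (2 * r) \<noteq> 0" using r(3) exp_gt_zero[of "- R"] by linarith
    then have "2 * r \<noteq> 0" "2 * r \<noteq> pi" by (metis sin_zero, metis sin_pi)
    then have "r \<noteq> 0" "r \<noteq> pi/2" by auto
    with r show "r \<in> I" by (auto simp: I_def)
  qed
  have out: "R \<le> u r" if "r \<in> I - K" for r
  proof -
    have "sin (2 * r) < exp (- R)" using that by (auto simp: I_def K_def)
    then have "ln (sin (2 * r)) < ln (exp (- R))" using pos[of r] that by (subst ln_less_cancel_iff) auto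
    then show ?thesis by (simp add: u_def)
  qed
  have du: "(u has_real_derivative - 2 * (cos (2 * r) / sin (2 * r))) (at r)" if "r \<in> I" for r
    unfolding u_def using pos[OF that] by (auto intro!: derivative_eq_intros simp: field_simps)
  have D1: "(f has_real_derivative f1 r) (at r)" if "r \<in> I" for r
    unfolding f_def f1_def by (rule DERIV_cong[OF DERIV_chain2[OF d1 du[OF that]]]) simp
  have dcot: "((\<lambda>r. cos (2 * r) / sin (2 * r)) has_real_derivative - 2 / (sin (2 * r))\<^sup>2) (at r)" if "r \<in> I" for r
  proof -
    have "- 2 / (sin (2 * r))\<^sup>2 = ((- 2 * sin (2 * r)) * sin (2 * r) - cos (2 * r) * (2 * cos (2 * r))) / (sin (2 * r) * sin (2 * r))"
      using pos[OF that] sin_cos_squared_add[of "2 * r"] by (simp add: divide_simps power2_eq_square)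
    then show ?thesis
      using pos[OF that] by (auto intro!: derivative_eq_intros)
  qed
  have D2: "(f1 has_real_derivative f2 r) (at r)" if "r \<in> I" for r
    unfolding f1_def
  proof (rule DERIV_cong[OF DERIV_mult[OF DERIV_cmult[OF dcot[OF that]] DERIV_chain2[OF d2 du[OF that]]]])
    show "- 2 * (- 2 / (sin (2 * r))\<^sup>2) * \<psi>1 (u r) + \<psi>2 (u r) * (- 2 * (cos (2 * r) / sin (2 * r))) * (- 2 * (cos (2 * r) / sin (2 * r))) = f2 r"
      unfolding f2_def by (simp add: power2_eq_square)
  qed
  have c\<psi>1: "continuous_on UNIV \<psi>1" by (rule DERIV_continuous_on[OF d2])
  have cu: "continuous_on I u" 
    by (rule DERIV_continuous_on[OF has_field_derivative_at_within[OF du]])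
  have nz: "sin (2 * r) \<noteq> 0" if "r \<in> I" for r using pos[OF that] by simp
  have cf2: "continuous_on I f2" unfolding f2_def
    by (intro continuous_intros continuous_on_compose2[OF c cu] continuous_on_compose2[OF c\<psi>1 cu]) (auto dest: nz)
  have zf: "f r = 0" "f1 r = 0" "f2 r = 0" if "r \<in> I - K" for r
    using z[OF out[OF that]] by (simp_all add: f_def f1_def f2_def)
  show ?thesis
  proof (intro exI[of _ F] conjI ballI)
    show "C2_compact_support {0<..<pi/2} F" unfolding F_def[abs_def] I_def[symmetric]
      by (rule C2_compact_support_zero_extension(1)[OF o K KI D1 D2 cf2 zf])
    fix r :: real assume r: "r \<in> {0<..<pi/2}"
    then have rI: "r \<in> I" by (simp add: I_def)
    have e: "exp (2 * u r) = 1 / (sin (2 * r))\<^sup>2"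
      using pos[OF rI] by (simp add: u_def exp_minus exp_double power_inverse divide_inverse)
    have cs: "(cos (2 * r))\<^sup>2 = 1 - (sin (2 * r))\<^sup>2" by (simp add: cos_squared_eq)
    have D1': "deriv F r = f1 r" unfolding F_def[abs_def]
      by (rule C2_compact_support_zero_extension(2)[OF o K KI D1 D2 cf2 zf rI])
    have D2': "deriv (deriv F) r = f2 r" unfolding F_def[abs_def]
      by (rule C2_compact_support_zero_extension(3)[OF o K KI D1 D2 cf2 zf rI])
    have "jacobi_generator F r = 1 / 2 * (f2 r + 2 * (cos (2 * r) / sin (2 * r)) * f1 r)"
      by (simp add: jacobi_generator_def D1' D2' cot_def)
    also have "\<dots> = 2 / (sin (2 * r))\<^sup>2 * \<psi>1 (u r) + 2 * ((cos (2 * r))\<^sup>2 / (sin (2 * r))\<^sup>2) * \<psi>2 (u r)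
        - 2 * ((cos (2 * r))\<^sup>2 / (sin (2 * r))\<^sup>2) * \<psi>1 (u r)"
      by (simp add: f1_def f2_def power2_eq_square algebra_simps)
    also have "(cos (2 * r))\<^sup>2 / (sin (2 * r))\<^sup>2 = exp (2 * u r) - 1"
      unfolding e cs using pos[OF rI] by (simp add: diff_divide_distrib)
    also have "2 / (sin (2 * r))\<^sup>2 = 2 * exp (2 * u r)" by (simp add: e)
    finally have "jacobi_generator F r = 2 * \<psi>1 (u r) + 2 * (exp (2 * u r) - 1) * \<psi>2 (u r)"
      by (simp add: algebra_simps)
    moreover have "F r = \<psi> (u r)" using rI by (simp add: F_def f_def)
    ultimately show "let u = - ln (sin (2 * r)) in
      F r = \<psi> u \<and> jacobi_generator F r = 2 * \<psi>1 u + 2 * (exp (2 * u) - 1) * \<psi>2 u"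
      by (simp add: u_def)
  qed
qed

lemma DERIV_pos_part_power:
  assumes "0 < k"
  shows "((\<lambda>x :: real. max 0 x ^ Suc k) has_real_derivative real (Suc k) * max 0 x ^ k) (at x)"
proof -
  consider "x < 0" | "x = 0" | "0 < x" by linarith
  then show ?thesis
  proof cases
    case 1
    have "((\<lambda>x :: real. max 0 x ^ Suc k) has_real_derivative 0) (at x)"
      by (rule has_field_derivative_transform_within_open[OF DERIV_const[of 0] open_lessThan[of 0]]) (use 1 in auto)
    with 1 assms show ?thesis by (simp add: power_0_left del: power_Suc)
  next
    case 2
    have "((\<lambda>h :: real. max 0 h ^ k) \<longlongrightarrow> max 0 0 ^ k) (at 0)" by (intro tendsto_intros)
    moreover have "\<forall>\<^sub>F h in at (0 :: real). max 0 h ^ k = max 0 h ^ Suc k / h"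
      using assms by (auto simp: eventually_at max_def intro!: exI[of _ 1])
    ultimately have "((\<lambda>h :: real. max 0 h ^ Suc k / h) \<longlongrightarrow> max 0 0 ^ k) (at 0)"
      by (rule Lim_transform_eventually)
    with 2 assms show ?thesis by (simp add: DERIV_def power_0_left)
  next
    case 3
    have "((\<lambda>x :: real. x ^ Suc k) has_real_derivative real (Suc k) * x ^ k) (at x)"
      using DERIV_pow[of "Suc k" x] by (simp del: power_Suc)
    then have "((\<lambda>x :: real. max 0 x ^ Suc k) has_real_derivative real (Suc k) * x ^ k) (at x)"
      by (rule has_field_derivative_transform_within_open[OF _ open_greaterThan[of 0]]) (use 3 in auto)
    with 3 show ?thesis by simp
  qed
qed

text \<open>
  The cut-off function has the exponent \<open>k = 3\<close>, the least one for which it is twice continuously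
  differentiable; the exponents 2 and 1 occur in its derivatives.
\<close>

definition cutoff :: "real \<Rightarrow> nat \<Rightarrow> real \<Rightarrow> real" where
  "cutoff n k u = max 0 (1 - u / n) ^ k"

definition test_fun :: "real \<Rightarrow> real \<Rightarrow> real \<Rightarrow> real" where
  "test_fun a n u = exp (- a * u) * cutoff n 3 u"

text \<open>
  The generator \<open>2 \<psi>' + 2 (exp (2u) - 1) \<psi>''\<close> applied to \<open>\<psi> = test_fun a n\<close>.
\<close>

definition test_gen :: "real \<Rightarrow> real \<Rightarrow> real \<Rightarrow> real" where
  "test_gen a n u = exp (- a * u) * (- 2 * a * cutoff n 3 u - 6 / n * cutoff n 2 u
     + 2 * (exp (2 * u) - 1) * (a\<^sup>2 * cutoff n 3 u + 6 * a / n * cutoff n 2 u + 6 / n\<^sup>2 * cutoff n 1 u))"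

lemma cutoff_bounds: "0 < n \<Longrightarrow> 0 \<le> u \<Longrightarrow> 0 \<le> cutoff n k u \<and> cutoff n k u \<le> 1"
  by (auto simp: cutoff_def max_def intro!: power_le_one)

lemma cutoff_eq_0: "0 < n \<Longrightarrow> 0 < k \<Longrightarrow> n \<le> u \<Longrightarrow> cutoff n k u = 0"
  by (simp add: cutoff_def max_def)

lemma DERIV_cutoff:
  assumes "0 < k" "0 < n" shows "(cutoff n (Suc k) has_real_derivative - real (Suc k) / n * cutoff n k u) (at u)"
proof -
  have "((\<lambda>u. 1 - u / n) has_real_derivative - 1 / n) (at u)"
    using assms(2) by (auto intro!: derivative_eq_intros)
  from DERIV_chain2[OF DERIV_pos_part_power[OF assms(1)] this]
  show ?thesis unfolding cutoff_def[abs_def] by (rule DERIV_cong) (simp add: algebra_simps diff_divide_distrib add_divide_distrib)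
qed

lemma continuous_on_cutoff [continuous_intros]:
  "continuous_on S g \<Longrightarrow> continuous_on S (\<lambda>x. cutoff n k (g x))"
  unfolding cutoff_def divide_inverse by (intro continuous_intros)

lemma jacobi_test_function:
  assumes n: "0 < n"
  shows "\<exists>f. C2_compact_support {0<..<pi/2} f \<and> (\<forall>r\<in>{0<..<pi/2}.
    f r = test_fun a n (- ln (sin (2 * r))) \<and> jacobi_generator f r = test_gen a n (- ln (sin (2 * r))))"
proof -
  define \<psi>1 where "\<psi>1 u = exp (- a * u) * (- a * cutoff n 3 u - 3 / n * cutoff n 2 u)" for u
  define \<psi>2 where "\<psi>2 u = exp (- a * u) * (a\<^sup>2 * cutoff n 3 u + 6 * a / n * cutoff n 2 u + 6 / n\<^sup>2 * cutoff n 1 u)" for u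
  have d: "(cutoff n 3 has_real_derivative - 3 / n * cutoff n 2 u) (at u)"
          "(cutoff n 2 has_real_derivative - 2 / n * cutoff n 1 u) (at u)" for u
    using DERIV_cutoff[of 2 n u] DERIV_cutoff[of 1 n u] n by (simp_all add: numeral_3_eq_3 numeral_2_eq_2)
  have e: "((\<lambda>u. exp (- a * u)) has_real_derivative - a * exp (- a * u)) (at u)" for u
    by (auto intro!: derivative_eq_intros)
  have d1: "(test_fun a n has_real_derivative \<psi>1 u) (at u)" for u
    unfolding test_fun_def[abs_def] \<psi>1_def
    by (rule DERIV_cong[OF DERIV_mult[OF e d(1)]]) (simp add: algebra_simps)
  have d2: "(\<psi>1 has_real_derivative \<psi>2 u) (at u)" for u
    unfolding \<psi>1_def[abs_def] \<psi>2_def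
    by (rule DERIV_cong[OF DERIV_mult[OF e DERIV_diff[OF DERIV_cmult[OF d(1)] DERIV_cmult[OF d(2)]]]])
       (simp add: algebra_simps power2_eq_square)
  have c: "continuous_on UNIV \<psi>2" unfolding \<psi>2_def by (intro continuous_intros)
  have z: "test_fun a n u = 0" "\<psi>1 u = 0" "\<psi>2 u = 0" if "n \<le> u" for u
    using n that by (simp_all add: test_fun_def \<psi>1_def \<psi>2_def cutoff_eq_0)
  have "test_gen a n u = 2 * \<psi>1 u + 2 * (exp (2 * u) - 1) * \<psi>2 u" for u
    by (simp add: test_gen_def \<psi>1_def \<psi>2_def algebra_simps)
  with jacobi_generator_log_sin[OF d1 d2 c z] show ?thesis by (simp add: Let_def)
qed

lemma test_fun_bounds: "0 \<le> a \<Longrightarrow> 0 < n \<Longrightarrow> 0 \<le> u \<Longrightarrow> 0 \<le> test_fun a n u \<and> test_fun a n u \<le> 1"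
  using cutoff_bounds[of n u 3] by (auto simp: test_fun_def intro!: mult_le_one)

lemma continuous_on_test_fun: "continuous_on UNIV (test_fun a n)"
  unfolding test_fun_def[abs_def] by (intro continuous_intros)

lemma continuous_on_test_gen: "continuous_on UNIV (test_gen a n)"
  unfolding test_gen_def[abs_def] by (intro continuous_intros)

lemma test_gen_bounded:
  assumes "0 < n" shows "\<exists>C. \<forall>u\<ge>0. \<bar>test_gen a n u\<bar> \<le> C"
proof -
  have "compact (test_gen a n ` {0..n})"
    by (intro compact_continuous_image continuous_on_subset[OF continuous_on_test_gen]) auto
  from compact_imp_bounded[OF this] obtain C where C: "\<And>u. u \<in> {0..n} \<Longrightarrow> \<bar>test_gen a n u\<bar> \<le> C"
    unfolding bounded_iff by fastforce
  moreover have "test_gen a n u = 0" if "n \<le> u" for u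
    using assms that by (simp add: test_gen_def cutoff_eq_0)
  ultimately have "\<bar>test_gen a n u\<bar> \<le> max C 0" if "0 \<le> u" for u
    using that C[of u] by (cases "n \<le> u") (auto simp: le_max_iff_disj)
  then show ?thesis by blast
qed

lemma cutoff_tendsto: "(\<lambda>n. cutoff (real (Suc n)) k u) \<longlonglongrightarrow> 1"
proof -
  have "(\<lambda>n. max 0 (1 - u * (1 / real (Suc n))) ^ k) \<longlonglongrightarrow> max 0 (1 - u * 0) ^ k"
    by (intro tendsto_intros LIMSEQ_Suc[OF lim_1_over_n])
  then show ?thesis by (simp add: cutoff_def)
qed

text \<open>
  For \<open>a = 1\<close>, up to the bounded term, the generator yields \<open>2 exp u\<close>, and this dominates
  \<open>2 u \<ge> 2 (1 - exp (- \<mu> u)) / \<mu>\<close>. All the terms that come from differentiating the cut-off are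
  nonnegative, except for one of size \<open>6 / n\<close>: the cut-off is decreasing and convex.
\<close>

lemma test_gen_dominates_defect:
  assumes n: "0 < n" and u: "0 \<le> u" and \<mu>: "0 < \<mu>"
  shows "cutoff n 3 u * (1 - exp (- \<mu> * u)) \<le> \<mu> / 2 * (test_gen 1 n u + (4 + 6 / n))"
proof -
  define A B C where "A = cutoff n 3 u" and "B = cutoff n 2 u" and "C = cutoff n 1 u"
  have b: "0 \<le> A" "A \<le> 1" "0 \<le> B" "B \<le> 1" "0 \<le> C" 
    using cutoff_bounds[OF n u] by (auto simp: A_def B_def C_def)
  define e where "e = exp (- u)"
  have e: "0 < e" "e \<le> 1" using u by (auto simp: e_def)
  have ee: "e * (exp (2 * u) - 1) = exp u - e" by (simp add: e_def algebra_simps flip: exp_add)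
  have eu: "e \<le> exp u" using u by (simp add: e_def)
  have "test_gen 1 n u = - 2 * (e * A) - 6 / n * (e * B) + 2 * (e * (exp (2 * u) - 1)) * (A + 6 / n * B + 6 / n\<^sup>2 * C)"
    by (simp add: test_gen_def A_def B_def C_def e_def algebra_simps add_divide_distrib diff_divide_distrib)
  also have "\<dots> = 2 * exp u * A - 4 * (e * A) - 6 / n * (e * B) + 2 * (exp u - e) * (6 / n * B + 6 / n\<^sup>2 * C)"
    unfolding ee by (simp add: algebra_simps)
  finally have t: "test_gen 1 n u = 2 * exp u * A - 4 * (e * A) - 6 / n * (e * B) + 2 * (exp u - e) * (6 / n * B + 6 / n\<^sup>2 * C)" .
  have "e * A \<le> 1" "e * B \<le> 1" using e b by (auto intro!: mult_le_one)
  moreover have "6 / n * (e * B) \<le> 6 / n * 1" by (rule mult_left_mono) (use \<open>e * B \<le> 1\<close> n in auto)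
  moreover define P where "P = 2 * (exp u - e) * (6 / n * B + 6 / n\<^sup>2 * C)"
  moreover have "0 \<le> P" unfolding P_def using eu b n by simp
  moreover have "test_gen 1 n u = 2 * exp u * A - 4 * (e * A) - 6 / n * (e * B) + P" unfolding t P_def ..
  ultimately have "2 * exp u * A \<le> test_gen 1 n u + (4 + 6 / n)" by linarith
  then have "\<mu> / 2 * (2 * exp u * A) \<le> \<mu> / 2 * (test_gen 1 n u + (4 + 6 / n))"
    using \<mu> by (intro mult_left_mono) auto
  moreover have "A * (1 - exp (- \<mu> * u)) \<le> A * (\<mu> * exp u)"
  proof (rule mult_left_mono[OF _ b(1)])
    have "1 - exp (- \<mu> * u) \<le> \<mu> * u" using exp_ge_add_one_self[of "- \<mu> * u"] by simp
    also have "\<dots> \<le> \<mu> * exp u" using \<mu> exp_ge_add_one_self[of u] by (intro mult_left_mono) linarith+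
    finally show "1 - exp (- \<mu> * u) \<le> \<mu> * exp u" .
  qed
  ultimately show ?thesis by (simp add: A_def mult_ac)
qed

text \<open>
  Without the cut-off the left-hand side would vanish: this is the eigenvalue equation
  \<open>L g = (2 \<mu>\<^sup>2 exp (2u) - 2 \<mu> (\<mu> + 1)) g\<close> for \<open>g = exp (- \<mu> u)\<close>. Every derivative of the cut-off costs
  a factor \<open>1 / n\<close>.
\<close>

lemma test_gen_almost_eigenfunction:
  assumes n: "1 \<le> n" and u: "0 \<le> u" and \<mu>: "0 < \<mu>"
  shows "\<bar>test_gen \<mu> n u + (2 * \<mu> * (\<mu> + 1) - 2 * \<mu>\<^sup>2 * exp (2 * u)) * test_fun \<mu> n u\<bar>
    \<le> (18 + 12 * \<mu>) / n * exp (2 * u)"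
proof -
  define A B C where "A = cutoff n 3 u" and "B = cutoff n 2 u" and "C = cutoff n 1 u"
  have n0: "0 < n" using n by simp
  have b: "0 \<le> B" "B \<le> 1" "0 \<le> C" "C \<le> 1" 
    using cutoff_bounds[OF n0 u] by (auto simp: B_def C_def)
  define E where "E = exp (2 * u)"
  have E: "1 \<le> E" using u by (simp add: E_def)
  define X where "X = - (6 / n * B) + 2 * (E - 1) * (6 * \<mu> / n * B + 6 / n\<^sup>2 * C)"
  have "test_gen \<mu> n u + (2 * \<mu> * (\<mu> + 1) - 2 * \<mu>\<^sup>2 * E) * test_fun \<mu> n u = exp (- \<mu> * u) * X"
    by (simp add: test_gen_def test_fun_def X_def A_def B_def C_def E_def algebra_simps power2_eq_square)
  also have "\<bar>\<dots>\<bar> \<le> 1 * \<bar>X\<bar>"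
    unfolding abs_mult by (rule mult_right_mono) (use u \<mu> in auto)
  also have "\<bar>X\<bar> \<le> 6 / n * E + 2 * E * (6 * \<mu> / n + 6 / n)"
  proof -
    have 1: "0 \<le> 6 / n * B" using b n0 by simp
    have 2: "6 / n * B \<le> 6 / n * E" using b n0 E by (intro mult_left_mono) auto
    have 3: "6 * \<mu> / n * B \<le> 6 * \<mu> / n * 1" using b n0 \<mu> by (intro mult_left_mono) auto
    have "6 / n\<^sup>2 * C \<le> 6 / n\<^sup>2 * 1" using b by (intro mult_left_mono) auto
    also have "\<dots> \<le> 6 / n" using n self_le_power[of n 2] by (simp add: frac_le)
    finally have 4: "6 / n\<^sup>2 * C \<le> 6 / n" .
    have 5: "0 \<le> 6 * \<mu> / n * B + 6 / n\<^sup>2 * C" using b n0 \<mu> by simp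
    have 6: "2 * (E - 1) * (6 * \<mu> / n * B + 6 / n\<^sup>2 * C) \<le> 2 * E * (6 * \<mu> / n + 6 / n)"
      by (rule mult_mono) (use 3 4 5 E in auto)
    have 7: "0 \<le> 2 * (E - 1) * (6 * \<mu> / n * B + 6 / n\<^sup>2 * C)" using 5 E by simp
    have 8: "0 \<le> 6 / n * E" using n0 E by simp
    show ?thesis unfolding X_def using 1 2 6 7 8 by linarith
  qed
  also have "6 / n * E + 2 * E * (6 * \<mu> / n + 6 / n) = (18 + 12 * \<mu>) / n * E"
    using n0 by (simp add: field_simps)
  finally show ?thesis by (simp add: E_def)
qed


section \<open>Exponential functionals of the Jacobi diffusion\<close>

lemma space_natural_filtration [simp]: "space (natural_filtration M X t) = space M"
  by (simp add: natural_filtration_def space_measure_of_conv)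

lemma sets_natural_filtration:
  "sets (natural_filtration M X t) =
     sigma_sets (space M) (\<Union>s\<in>{0..t}. {X s -` A \<inter> space M |A. A \<in> sets borel})"
  unfolding natural_filtration_def by (rule sets_measure_of) auto

lemma subalgebra_natural_filtration:
  assumes "\<And>s. 0 \<le> s \<Longrightarrow> X s \<in> borel_measurable M"
  shows "subalgebra M (natural_filtration M X t)"
proof -
  have "(\<Union>s\<in>{0..t}. {X s -` A \<inter> space M |A. A \<in> sets borel}) \<subseteq> sets M"
    using assms by (auto intro: measurable_sets)
  then show ?thesis
    unfolding subalgebra_def sets_natural_filtration by (simp add: sets.sigma_sets_subset)
qed

lemma measurable_natural_filtration:
  assumes "0 \<le> s" "s \<le> t"
  shows "X s \<in> borel_measurable (natural_filtration M X t)"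
proof (rule measurableI)
  fix A :: "real set" assume "A \<in> sets borel"
  then show "X s -` A \<inter> space (natural_filtration M X t) \<in> sets (natural_filtration M X t)"
    unfolding sets_natural_filtration space_natural_filtration
    using assms by (intro sigma_sets.Basic) force
qed simp

text \<open>
  The test functions are known explicitly only on the open interval, where the diffusion lives, so
  the martingales they produce agree with the explicit ones on the sample space and for nonnegative
  times.
\<close>

lemma (in prob_space) martingale_cong:
  assumes m: "martingale M F N" and sub: "\<And>s. subalgebra M (F s)"
    and eq: "\<And>t \<omega>. 0 \<le> t \<Longrightarrow> \<omega> \<in> space M \<Longrightarrow> N t \<omega> = N' t \<omega>"
  shows "martingale M F N'"
  unfolding martingale_def
proof safe
  fix t :: real assume t: "0 \<le> t"
  have "space (F t) = space M" using sub by (simp add: subalgebra_def)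
  then show "N' t \<in> borel_measurable (F t)"
    using m t eq[OF t] measurable_cong[of "F t" "N t" "N' t" borel] by (simp add: martingale_def)
  show "integrable M (N' t)"
    using m t Bochner_Integration.integrable_cong[of M M "N t" "N' t", OF refl eq[OF t]]
    by (simp add: martingale_def)
next
  fix s t :: real assume s: "0 \<le> s" "s \<le> t"
  interpret f: finite_measure_subalgebra M "F s"
    using sub[of s] by unfold_locales
  have t: "0 \<le> t" using s by simp
  have i: "integrable M (N t)" using m t by (simp add: martingale_def)
  then have i': "integrable M (N' t)" using Bochner_Integration.integrable_cong[of M M "N t" "N' t", OF refl eq[OF t]] by simp
  have "AE \<omega> in M. real_cond_exp M (F s) (N t) \<omega> = real_cond_exp M (F s) (N' t) \<omega>"
    by (rule f.real_cond_exp_cong)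
       (use eq[OF t] borel_measurable_integrable[OF i] borel_measurable_integrable[OF i'] in auto)
  moreover have "AE \<omega> in M. real_cond_exp M (F s) (N t) \<omega> = N s \<omega>"
    using m s by (simp add: martingale_def)
  ultimately show "AE \<omega> in M. real_cond_exp M (F s) (N' t) \<omega> = N' s \<omega>"
    using AE_space by eventually_elim (use eq[OF s(1)] in auto)
qed

locale jacobi_process = prob_space M for M :: "'a measure" +
  fixes r0 :: real and r :: "real \<Rightarrow> 'a \<Rightarrow> real"
  assumes r0: "0 < r0" "r0 < pi / 2" and jacobi: "jacobi_diffusion M r0 r"
begin

definition U :: "real \<Rightarrow> 'a \<Rightarrow> real" where "U s \<omega> = - ln (sin (2 * r s \<omega>))"
definition u0 :: real where "u0 = - ln (sin (2 * r0))"
definition clock :: "real \<Rightarrow> 'a \<Rightarrow> real" where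
  "clock t \<omega> = (LINT s:{0..t}|lborel. 4 / (sin (2 * r s \<omega>))\<^sup>2)"

abbreviation "F \<equiv> natural_filtration M r"

lemma r_measurable: "0 \<le> s \<Longrightarrow> r s \<in> borel_measurable M"
  and r_cont: "\<omega> \<in> space M \<Longrightarrow> continuous_on {0..} (\<lambda>s. r s \<omega>)"
  and r_in: "\<omega> \<in> space M \<Longrightarrow> 0 \<le> s \<Longrightarrow> r s \<omega> \<in> {0<..<pi/2}"
  and r_start: "AE \<omega> in M. r 0 \<omega> = r0"
  and r_mart: "C2_compact_support {0<..<pi/2} f \<Longrightarrow> martingale M F
     (\<lambda>t \<omega>. f (r t \<omega>) - f (r 0 \<omega>) - (LINT s:{0..t}|lborel. jacobi_generator f (r s \<omega>)))"
  using jacobi unfolding jacobi_diffusion_def diffusion_def by blast+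

lemma sin_r_pos: "\<omega> \<in> space M \<Longrightarrow> 0 \<le> s \<Longrightarrow> 0 < sin (2 * r s \<omega>)"
  using sin_2_pos r_in by blast

lemma U_nonneg: "\<omega> \<in> space M \<Longrightarrow> 0 \<le> s \<Longrightarrow> 0 \<le> U s \<omega>"
  unfolding U_def using sin_r_pos[of \<omega> s] by simp

lemma u0_nonneg: "0 \<le> u0"
  unfolding u0_def using sin_2_pos[of r0] r0 by simp

lemma exp_2U: "\<omega> \<in> space M \<Longrightarrow> 0 \<le> s \<Longrightarrow> exp (2 * U s \<omega>) = 1 / (sin (2 * r s \<omega>))\<^sup>2"
  unfolding U_def using sin_r_pos[of \<omega> s] by (simp add: exp_minus exp_double power_inverse divide_inverse)

lemma F_subalgebra: "subalgebra M (F s)"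
  by (rule subalgebra_natural_filtration[OF r_measurable])

text \<open>
  For both the ambient measure and the natural filtration, whence the abstract \<open>N\<close>.
\<close>

lemma cont_process_U_wrt:
  assumes "space N = space M" "\<And>s. 0 \<le> s \<Longrightarrow> s \<le> T \<Longrightarrow> r s \<in> borel_measurable N"
  shows "cont_process N T U"
proof (rule cont_processI)
  fix s assume "0 \<le> s" "s \<le> T"
  then have [measurable]: "r s \<in> borel_measurable N" by (rule assms(2))
  show "U s \<in> borel_measurable N" unfolding U_def[abs_def] by measurable
next
  fix \<omega> assume "\<omega> \<in> space N"
  then have w: "\<omega> \<in> space M" using assms by simp
  have c: "continuous_on {0..T} (\<lambda>s. r s \<omega>)" by (rule continuous_on_subset[OF r_cont[OF w]]) auto
  show "continuous_on {0..T} (\<lambda>s. U s \<omega>)" unfolding U_def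
    by (intro continuous_intros c) (use sin_r_pos[OF w] in \<open>auto simp: less_le\<close>)
qed

lemma cont_process_U: "cont_process M T U"
  by (rule cont_process_U_wrt) (auto intro: r_measurable)

lemma cont_process_U_adapted: "cont_process (F s) s U"
  by (rule cont_process_U_wrt) (auto intro: measurable_natural_filtration)

lemma U_start: "AE \<omega> in M. U 0 \<omega> = u0"
  using r_start by eventually_elim (simp add: U_def u0_def)

lemma clock_eq: "\<omega> \<in> space M \<Longrightarrow> clock t \<omega> = (LINT s:{0..t}|lborel. 4 * exp (2 * U s \<omega>))"
  unfolding clock_def by (rule set_lebesgue_integral_cong) (auto simp: exp_2U)

lemma cont_process_exp_U: "cont_process M T (\<lambda>s \<omega>. 4 * exp (2 * U s \<omega>))"
  by (intro cont_process_compose[OF cont_process_U] continuous_intros)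

lemma clock_measurable [measurable]: "0 \<le> t \<Longrightarrow> clock t \<in> borel_measurable M"
  by (rule iffD2[OF measurable_cong[of M "clock t", OF clock_eq] cont_process_integral_measurable[OF cont_process_exp_U]])

lemma clock_mono:
  assumes w: "\<omega> \<in> space M" and st: "s \<le> t"
  shows "clock s \<omega> \<le> clock t \<omega>"
proof -
  have i: "integrable lborel (\<lambda>s. indicator {0..t} s *\<^sub>R (4 * exp (2 * U s \<omega>)))" for t
    using borel_integrable_atLeastAtMost'[OF cont_processD(2)[OF cont_process_exp_U w]] unfolding set_integrable_def .
  show ?thesis
    unfolding clock_eq[OF w] set_lebesgue_integral_def
    by (rule integral_mono[OF i i]) (use st in \<open>auto simp: indicator_def\<close>)
qed

lemma clock_nonneg: "0 \<le> clock t \<omega>"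
  unfolding clock_def set_lebesgue_integral_def by (intro integral_nonneg_AE AE_I2) auto

lemma test_martingale:
  assumes n: "0 < n"
  shows "martingale M F (\<lambda>t \<omega>. test_fun a n (U t \<omega>) - test_fun a n (U 0 \<omega>)
    - (LINT s:{0..t}|lborel. test_gen a n (U s \<omega>)))"
proof -
  from jacobi_test_function[OF n, of a] obtain f where f: "C2_compact_support {0<..<pi/2} f"
    and e: "\<And>x. x \<in> {0<..<pi/2} \<Longrightarrow> f x = test_fun a n (- ln (sin (2 * x)))"
      "\<And>x. x \<in> {0<..<pi/2} \<Longrightarrow> jacobi_generator f x = test_gen a n (- ln (sin (2 * x)))" by blast
  show ?thesis
  proof (rule martingale_cong[OF r_mart[OF f] F_subalgebra])
    fix t \<omega> assume t: "0 \<le> (t :: real)" and w: "\<omega> \<in> space M"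
    have i: "(LINT s:{0..t}|lborel. jacobi_generator f (r s \<omega>)) = (LINT s:{0..t}|lborel. test_gen a n (U s \<omega>))"
    proof (rule set_lebesgue_integral_cong)
      show "\<forall>x. x \<in> {0..t} \<longrightarrow> jacobi_generator f (r x \<omega>) = test_gen a n (U x \<omega>)"
        using e(2) r_in[OF w] by (simp add: U_def)
    qed simp
    show "f (r t \<omega>) - f (r 0 \<omega>) - (LINT s:{0..t}|lborel. jacobi_generator f (r s \<omega>)) =
        test_fun a n (U t \<omega>) - test_fun a n (U 0 \<omega>) - (LINT s:{0..t}|lborel. test_gen a n (U s \<omega>))"
      unfolding i using e(1) r_in[OF w t] r_in[OF w, of 0] by (simp add: U_def)
  qed
qed

lemma test_Feynman_Kac:
  fixes w :: "real \<Rightarrow> real"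
  assumes n: "0 < n" and a: "0 \<le> a" and T: "0 \<le> T"
    and w: "continuous_on UNIV w" "0 \<le> \<kappa>" "\<And>u. 0 \<le> u \<Longrightarrow> w u \<le> \<kappa>"
  defines "G \<equiv> \<lambda>s \<omega>. exp (LINT v:{0..s}|lborel. w (U v \<omega>))"
  shows "expectation (\<lambda>\<omega>. G T \<omega> * test_fun a n (U T \<omega>)) = test_fun a n u0 +
      expectation (\<lambda>\<omega>. LINT s:{0..T}|lborel. G s \<omega> * (test_gen a n (U s \<omega>) + w (U s \<omega>) * test_fun a n (U s \<omega>)))"
    and "integrable M (\<lambda>\<omega>. LINT s:{0..T}|lborel. G s \<omega> * (test_gen a n (U s \<omega>) + w (U s \<omega>) * test_fun a n (U s \<omega>)))"
proof -
  obtain C where C: "\<And>u. 0 \<le> u \<Longrightarrow> \<bar>test_gen a n u\<bar> \<le> C" using test_gen_bounded[OF n] by blast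
  have Y: "cont_process M T (\<lambda>s \<omega>. test_fun a n (U s \<omega>))"
    by (rule cont_process_compose[OF cont_process_U continuous_on_test_fun])
  have h: "cont_process M T (\<lambda>s \<omega>. test_gen a n (U s \<omega>))"
    by (rule cont_process_compose[OF cont_process_U continuous_on_test_gen])
  have W: "cont_process M T (\<lambda>s \<omega>. w (U s \<omega>))" by (rule cont_process_compose[OF cont_process_U w(1)])
  have Wa: "cont_process (F s) s (\<lambda>s \<omega>. w (U s \<omega>))" for s by (rule cont_process_compose[OF cont_process_U_adapted w(1)])
  have bY: "\<bar>test_fun a n (U s \<omega>)\<bar> \<le> 1" if "\<omega> \<in> space M" "s \<in> {0..T}" for s \<omega>
    using test_fun_bounds[OF a n U_nonneg[of \<omega> s]] that by auto
  have bh: "\<bar>test_gen a n (U s \<omega>)\<bar> \<le> C" if "\<omega> \<in> space M" "s \<in> {0..T}" for s \<omega>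
    using C[OF U_nonneg[of \<omega> s]] that by auto
  have bw: "w (U s \<omega>) \<le> \<kappa>" if "\<omega> \<in> space M" "s \<in> {0..T}" for s \<omega>
    using w(3)[OF U_nonneg[of \<omega> s]] that by auto
  have st: "AE \<omega> in M. test_fun a n (U 0 \<omega>) = test_fun a n u0" using U_start by eventually_elim simp
  note fk = Feynman_Kac[OF F_subalgebra T Y bY h bh test_martingale[OF n] W Wa w(2) bw st]
  show "expectation (\<lambda>\<omega>. G T \<omega> * test_fun a n (U T \<omega>)) = test_fun a n u0 +
      expectation (\<lambda>\<omega>. LINT s:{0..T}|lborel. G s \<omega> * (test_gen a n (U s \<omega>) + w (U s \<omega>) * test_fun a n (U s \<omega>)))"
    unfolding G_def by (rule fk(1))
  show "integrable M (\<lambda>\<omega>. LINT s:{0..T}|lborel. G s \<omega> * (test_gen a n (U s \<omega>) + w (U s \<omega>) * test_fun a n (U s \<omega>)))"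
    unfolding G_def by (rule fk(2))
qed

text \<open>
  Apply the martingale problem to \<open>exp (- u)\<close>, that is to \<open>sin (2r)\<close>, whose expectation stays between
  0 and 1, so that the expected time integral of its image under the generator is at most 1. By
  \<open>test_gen_dominates_defect\<close> this bounds the occupation integral up to the cut-off, which disappears
  for \<open>n \<rightarrow> \<infinity>\<close> by dominated convergence.
\<close>

lemma occupation_bound:
  assumes \<mu>: "0 < \<mu>" and T: "0 \<le> T"
  shows "expectation (\<lambda>\<omega>. LINT s:{0..T}|lborel. 1 - exp (- \<mu> * U s \<omega>)) \<le> \<mu> / 2 * (1 + 4 * T)"
proof -
  define J where "J n \<omega> = (LINT s:{0..T}|lborel. cutoff n 3 (U s \<omega>) * (1 - exp (- \<mu> * U s \<omega>)))" for n \<omega>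
  have cJ: "cont_process M T (\<lambda>s \<omega>. cutoff n 3 (U s \<omega>) * (1 - exp (- \<mu> * U s \<omega>)))" for n
    by (intro cont_process_compose[OF cont_process_U] continuous_intros)
  have c1: "cont_process M T (\<lambda>s \<omega>. 1 - exp (- \<mu> * U s \<omega>))"
    by (intro cont_process_compose[OF cont_process_U] continuous_intros)
  have b: "0 \<le> cutoff n 3 (U s \<omega>) * (1 - exp (- \<mu> * U s \<omega>))" "cutoff n 3 (U s \<omega>) * (1 - exp (- \<mu> * U s \<omega>)) \<le> 1"
    if "\<omega> \<in> space M" "s \<in> {0..T}" "0 < n" for \<omega> s n
    using cutoff_bounds[OF that(3) U_nonneg[OF that(1)], of s 3] U_nonneg[OF that(1), of s] that(2) \<mu>
    by (auto intro!: mult_le_one)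
  have lim: "(\<lambda>n. J (real (Suc n)) \<omega>) \<longlonglongrightarrow> (LINT s:{0..T}|lborel. 1 - exp (- \<mu> * U s \<omega>))" if w: "\<omega> \<in> space M" for \<omega>
    unfolding J_def set_lebesgue_integral_def
  proof (rule integral_dominated_convergence[where w = "\<lambda>s. indicator {0..T} s"])
    show "AE s in lborel. (\<lambda>n. indicator {0..T} s *\<^sub>R (cutoff (real (Suc n)) 3 (U s \<omega>) * (1 - exp (- \<mu> * U s \<omega>))))
        \<longlonglongrightarrow> indicator {0..T} s *\<^sub>R (1 - exp (- \<mu> * U s \<omega>))"
      by (rule AE_I2) (intro tendsto_scaleR tendsto_const tendsto_mult[OF cutoff_tendsto tendsto_const, THEN tendsto_eq_rhs], simp)
    show "AE s in lborel. norm (indicator {0..T} s *\<^sub>R (cutoff (real (Suc n)) 3 (U s \<omega>) * (1 - exp (- \<mu> * U s \<omega>)))) \<le> indicator {0..T} s" for n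
      by (rule AE_I2) (use b[OF w, of _ "real (Suc n)"] in \<open>auto simp: indicator_def abs_mult[symmetric] simp del: of_nat_Suc\<close>)
    show "(\<lambda>s. indicator {0..T} s *\<^sub>R (1 - exp (- \<mu> * U s \<omega>))) \<in> borel_measurable lborel"
      using borel_integrable_atLeastAtMost'[OF cont_processD(2)[OF c1 w]] unfolding set_integrable_def
      by (rule borel_measurable_integrable)
    show "(\<lambda>s. indicator {0..T} s *\<^sub>R (cutoff (real (Suc n)) 3 (U s \<omega>) * (1 - exp (- \<mu> * U s \<omega>)))) \<in> borel_measurable lborel" for n
      using borel_integrable_atLeastAtMost'[OF cont_processD(2)[OF cJ w]] unfolding set_integrable_def
      by (rule borel_measurable_integrable)
  qed (use T in simp)
  have Jb: "0 \<le> J n \<omega>" "J n \<omega> \<le> T" if w: "\<omega> \<in> space M" and n: "0 < n" for \<omega> n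
  proof -
    have "(LINT s:{0..T}|lborel. 0) \<le> J n \<omega>" unfolding J_def
      by (intro integral_path_mono cont_processD(2)[OF cJ w] b w n continuous_intros)
    then show "0 \<le> J n \<omega>" by simp
    have "J n \<omega> \<le> (LINT s:{0..T}|lborel. 1)" unfolding J_def
      by (intro integral_path_mono cont_processD(2)[OF cJ w] b w n continuous_intros)
    then show "J n \<omega> \<le> T" using T by (simp add: set_integral_const)
  qed
  have Jm: "J n \<in> borel_measurable M" for n
    unfolding J_def[abs_def] by (rule cont_process_integral_measurable[OF cJ T])
  have elim: "(\<lambda>n. expectation (J (real (Suc n)))) \<longlonglongrightarrow> expectation (\<lambda>\<omega>. LINT s:{0..T}|lborel. 1 - exp (- \<mu> * U s \<omega>))"
  proof (rule integral_dominated_convergence[where w = "\<lambda>_. T"])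
    show "AE \<omega> in M. norm (J (real (Suc n)) \<omega>) \<le> T" for n
      by (rule AE_I2) (use Jb[of _ "real (Suc n)"] in auto)
  qed (use lim cont_process_integral_measurable[OF c1 T] Jm in \<open>auto intro!: AE_I2\<close>)
  have EJ: "expectation (J n) \<le> \<mu> / 2 * (1 + (4 + 6 / n) * T)" if n: "0 < n" for n
  proof -
    define R where "R \<omega> = (LINT s:{0..T}|lborel. test_gen 1 n (U s \<omega>))" for \<omega>
    have ER: "expectation (\<lambda>\<omega>. test_fun 1 n (U T \<omega>)) = test_fun 1 n u0 + expectation R" "integrable M R"
      using test_Feynman_Kac[OF n _ T, of 1 "\<lambda>_. 0" 0] by (simp_all add: R_def[abs_def])
    have "expectation (\<lambda>\<omega>. test_fun 1 n (U T \<omega>)) \<le> 1"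
    proof (rule integral_le_const)
      show "integrable M (\<lambda>\<omega>. test_fun 1 n (U T \<omega>))"
        using cont_processD(1)[OF cont_process_compose[OF cont_process_U[of T] continuous_on_test_fun], of T] T
          test_fun_bounds[OF _ n U_nonneg[of _ T]]
        by (intro integrable_const_bound[where B = 1]) auto
    qed (use test_fun_bounds[OF _ n U_nonneg[of _ T]] T in \<open>auto intro!: AE_I2\<close>)
    then have R1: "expectation R \<le> 1" using ER(1) test_fun_bounds[of 1 n u0] n u0_nonneg by auto
    have JR: "J n \<omega> \<le> \<mu> / 2 * (R \<omega> + (4 + 6 / n) * T)" if w: "\<omega> \<in> space M" for \<omega>
    proof -
      have ch: "continuous_on {0..T} (\<lambda>s. test_gen 1 n (U s \<omega>))"
        by (rule cont_processD(2)[OF cont_process_compose[OF cont_process_U continuous_on_test_gen] w])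
      have "J n \<omega> \<le> (LINT s:{0..T}|lborel. \<mu> / 2 * (test_gen 1 n (U s \<omega>) + (4 + 6 / n)))"
        unfolding J_def
        by (intro integral_path_mono cont_processD(2)[OF cJ w] continuous_intros ch test_gen_dominates_defect n \<mu> U_nonneg w) auto
      also have "\<dots> = \<mu> / 2 * (R \<omega> + (4 + 6 / n) * T)"
        using T set_integral_add(2)[OF borel_integrable_atLeastAtMost'[OF ch] borel_integrable_atLeastAtMost'[of 0 T "\<lambda>_. 4 + 6 / n"]]
        by (simp add: R_def set_integral_const)
      finally show ?thesis .
    qed
    have "expectation (J n) \<le> expectation (\<lambda>\<omega>. \<mu> / 2 * (R \<omega> + (4 + 6 / n) * T))"
    proof (rule integral_mono)
      show "integrable M (J n)"
        using Jm Jb[OF _ n] by (intro integrable_const_bound[where B = T]) auto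
    qed (use ER(2) JR in auto)
    also have "\<dots> = \<mu> / 2 * (expectation R + (4 + 6 / n) * T)" using ER(2) by (simp add: prob_space)
    also have "\<dots> \<le> \<mu> / 2 * (1 + (4 + 6 / n) * T)" using R1 \<mu> by (intro mult_left_mono) auto
    finally show ?thesis .
  qed
  have "(\<lambda>n. \<mu> / 2 * (1 + (4 + 6 * (1 / real (Suc n))) * T)) \<longlonglongrightarrow> \<mu> / 2 * (1 + (4 + 6 * 0) * T)"
    by (intro tendsto_intros LIMSEQ_Suc[OF lim_1_over_n])
  then have "(\<lambda>n. \<mu> / 2 * (1 + (4 + 6 / real (Suc n)) * T)) \<longlonglongrightarrow> \<mu> / 2 * (1 + 4 * T)" by simp
  from LIMSEQ_le[OF elim this] show ?thesis using EJ by (auto simp del: of_nat_Suc)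
qed


text \<open>
  Feynman-Kac with the rate \<open>w\<close> for which \<open>exp (- \<mu> u)\<close> would be harmonic without the cut-off. The
  error is at most a multiple of \<open>1/n\<close> times \<open>\<integral> G exp (2U)\<close>, and that integral is bounded pathwise since
  \<open>2 \<mu>\<^sup>2 exp (2U) G = \<kappa> G - G'\<close>: the killing pays for the unbounded integrand.
\<close>

lemma exponential_functional:
  assumes \<mu>: "0 < \<mu>" and T: "0 \<le> T"
  shows "expectation (\<lambda>\<omega>. exp (- (\<mu>\<^sup>2 / 2) * clock T \<omega>) * exp (- \<mu> * U T \<omega>)) =
    exp (- \<mu> * u0 - 2 * \<mu> * (\<mu> + 1) * T)"
proof -
  define \<kappa> where "\<kappa> = 2 * \<mu> * (\<mu> + 1)"
  define w where "w u = \<kappa> - 2 * \<mu>\<^sup>2 * exp (2 * u)" for u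
  define G where "G s \<omega> = exp (LINT v:{0..s}|lborel. w (U v \<omega>))" for s \<omega>
  define L where "L = (\<kappa> * exp (\<kappa> * T) * T + 1) / (2 * \<mu>\<^sup>2)"
  define R where "R n \<omega> = (LINT s:{0..T}|lborel. G s \<omega> * (test_gen \<mu> n (U s \<omega>) + w (U s \<omega>) * test_fun \<mu> n (U s \<omega>)))" for n \<omega>
  have \<kappa>: "0 \<le> \<kappa>" using \<mu> by (simp add: \<kappa>_def)
  have wc: "continuous_on UNIV w" unfolding w_def[abs_def] by (intro continuous_intros)
  have wb: "w u \<le> \<kappa>" for u unfolding w_def by simp
  have W: "cont_process M T (\<lambda>s \<omega>. w (U s \<omega>))" by (rule cont_process_compose[OF cont_process_U wc])
  have G: "cont_process M T G" unfolding G_def by (intro cont_process_compose[OF cont_process_integral[OF W]] continuous_intros)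
  have Geq: "G s \<omega> = exp (\<kappa> * s) * exp (- (\<mu>\<^sup>2 / 2) * clock s \<omega>)" if om: "\<omega> \<in> space M" and s: "0 \<le> s" for s \<omega>
  proof -
    have c: "continuous_on {0..s} (\<lambda>v. (\<mu>\<^sup>2 / 2) * (4 * exp (2 * U v \<omega>)))"
      by (intro continuous_intros cont_processD(2)[OF cont_process_U om])
    have "(LINT v:{0..s}|lborel. w (U v \<omega>)) = (LINT v:{0..s}|lborel. \<kappa> - (\<mu>\<^sup>2 / 2) * (4 * exp (2 * U v \<omega>)))"
      by (rule arg_cong[where f = "set_lebesgue_integral _ _"]) (simp add: w_def fun_eq_iff)
    also have "\<dots> = (LINT v:{0..s}|lborel. \<kappa>) - (LINT v:{0..s}|lborel. (\<mu>\<^sup>2 / 2) * (4 * exp (2 * U v \<omega>)))"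
      by (intro set_integral_diff borel_integrable_atLeastAtMost' c continuous_intros)
    also have "\<dots> = \<kappa> * s - (\<mu>\<^sup>2 / 2) * clock s \<omega>"
      using s unfolding clock_eq[OF om] by (simp add: set_integral_const)
    finally show ?thesis by (simp add: G_def flip: exp_add)
  qed
  have Gb: "0 \<le> G s \<omega>" "G s \<omega> \<le> exp (\<kappa> * T)" if om: "\<omega> \<in> space M" and s: "s \<in> {0..T}" for s \<omega>
  proof -
    have s0: "0 \<le> s" using s by simp
    have "G s \<omega> \<le> exp (\<kappa> * s) * 1" unfolding Geq[OF om s0]
      by (rule mult_left_mono) (use clock_nonneg[of s \<omega>] in simp_all)
    also have "\<dots> \<le> exp (\<kappa> * T)" using s mult_left_mono[OF _ \<kappa>, of s T] by simp
    finally show "G s \<omega> \<le> exp (\<kappa> * T)" .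
  qed (simp add: G_def)
  have occ: "(LINT s:{0..T}|lborel. G s \<omega> * exp (2 * U s \<omega>)) \<le> L" if om: "\<omega> \<in> space M" for \<omega>
  proof -
    note c = cont_processD(2)[OF cont_process_U om] cont_processD(2)[OF G om] cont_processD(2)[OF W om]
    have "((\<lambda>s. G s \<omega>) has_real_derivative w (U s \<omega>) * G s \<omega>) (at s within {0..T})" if "s \<in> {0..T}" for s
      unfolding G_def by (rule derivative_eq_intros integral_path_deriv[OF c(3) that] refl)+ simp
    then have "(LINT s:{0..T}|lborel. w (U s \<omega>) * G s \<omega>) = G T \<omega> - G 0 \<omega>"
      by (intro integral_path_FTC[OF T] continuous_intros c)
    then have e: "(LINT s:{0..T}|lborel. w (U s \<omega>) * G s \<omega>) = G T \<omega> - 1"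
      by (simp add: G_def integral_path_0 del: atLeastAtMost_singleton)
    have "2 * \<mu>\<^sup>2 * (LINT s:{0..T}|lborel. G s \<omega> * exp (2 * U s \<omega>)) =
        (LINT s:{0..T}|lborel. \<kappa> * G s \<omega> - w (U s \<omega>) * G s \<omega>)"
      unfolding set_integral_mult_right[symmetric] by (simp add: w_def algebra_simps)
    also have "\<dots> = (LINT s:{0..T}|lborel. \<kappa> * G s \<omega>) - (G T \<omega> - 1)"
      unfolding e[symmetric] by (intro set_integral_diff borel_integrable_atLeastAtMost' c continuous_intros)
    also have "\<dots> \<le> (LINT s:{0..T}|lborel. \<kappa> * exp (\<kappa> * T)) + 1"
    proof -
      have "(LINT s:{0..T}|lborel. \<kappa> * G s \<omega>) \<le> (LINT s:{0..T}|lborel. \<kappa> * exp (\<kappa> * T))"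
        by (intro integral_path_mono c continuous_intros mult_left_mono Gb om \<kappa>)
      then show ?thesis using Gb(1)[OF om, of T] T by simp
    qed
    also have "\<dots> = \<kappa> * exp (\<kappa> * T) * T + 1" using T by (simp add: set_integral_const)
    finally show ?thesis using \<mu> by (simp add: L_def field_simps)
  qed
  have Rb: "\<bar>R n \<omega>\<bar> \<le> (18 + 12 * \<mu>) / n * L" if om: "\<omega> \<in> space M" and n: "1 \<le> n" for n \<omega>
  proof -
    note c = cont_processD(2)[OF cont_process_U om] cont_processD(2)[OF G om] cont_processD(2)[OF W om]
      cont_processD(2)[OF cont_process_compose[OF cont_process_U continuous_on_test_fun] om]
      cont_processD(2)[OF cont_process_compose[OF cont_process_U continuous_on_test_gen] om]
    have "\<bar>R n \<omega>\<bar> \<le> (LINT s:{0..T}|lborel. \<bar>G s \<omega> * (test_gen \<mu> n (U s \<omega>) + w (U s \<omega>) * test_fun \<mu> n (U s \<omega>))\<bar>)"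
      unfolding R_def set_lebesgue_integral_def
      by (rule order_trans[OF integral_abs_bound]) (simp add: abs_mult)
    also have "\<dots> \<le> (LINT s:{0..T}|lborel. (18 + 12 * \<mu>) / n * (G s \<omega> * exp (2 * U s \<omega>)))"
    proof (intro integral_path_mono continuous_intros c)
      fix s assume s: "s \<in> {0..T}"
      have "0 \<le> U s \<omega>" using U_nonneg[OF om] s by simp
      from mult_left_mono[OF test_gen_almost_eigenfunction[OF n this \<mu>] Gb(1)[OF om s]]
      show "\<bar>G s \<omega> * (test_gen \<mu> n (U s \<omega>) + w (U s \<omega>) * test_fun \<mu> n (U s \<omega>))\<bar>
          \<le> (18 + 12 * \<mu>) / n * (G s \<omega> * exp (2 * U s \<omega>))"
        using Gb(1)[OF om s] by (simp add: w_def \<kappa>_def abs_mult mult_ac)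
    qed
    also have "\<dots> = (18 + 12 * \<mu>) / n * (LINT s:{0..T}|lborel. G s \<omega> * exp (2 * U s \<omega>))"
      by (rule set_integral_mult_right)
    also have "\<dots> \<le> (18 + 12 * \<mu>) / n * L" by (rule mult_left_mono[OF occ[OF om]]) (use n \<mu> in auto)
    finally show ?thesis .
  qed
  define E where "E n = expectation (\<lambda>\<omega>. G T \<omega> * test_fun \<mu> (real (Suc n)) (U T \<omega>))" for n
  have near: "\<bar>E n - test_fun \<mu> (real (Suc n)) u0\<bar> \<le> (18 + 12 * \<mu>) * L * (1 / real (Suc n))" for n
  proof -
    have n: "1 \<le> real (Suc n)" by simp
    then have n0: "0 < real (Suc n)" by simp
    note fk = test_Feynman_Kac[OF n0 less_imp_le[OF \<mu>] T wc \<kappa> wb]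
    have "E n - test_fun \<mu> (real (Suc n)) u0 = expectation (R (real (Suc n)))"
      using fk(1) unfolding E_def G_def R_def[abs_def] by simp
    also have "\<bar>\<dots>\<bar> \<le> expectation (\<lambda>\<omega>. \<bar>R (real (Suc n)) \<omega>\<bar>)" by (rule integral_abs_bound)
    also have "\<dots> \<le> (18 + 12 * \<mu>) / real (Suc n) * L"
    proof (rule integral_le_const)
      show "integrable M (\<lambda>\<omega>. \<bar>R (real (Suc n)) \<omega>\<bar>)" using fk(2) unfolding G_def R_def by (rule integrable_abs)
    qed (use Rb[OF _ n] in \<open>auto intro!: AE_I2\<close>)
    finally show ?thesis by simp
  qed
  have GTm: "G T \<in> borel_measurable M" "U T \<in> borel_measurable M"
    using cont_processD(1)[OF G, of T] cont_processD(1)[OF cont_process_U[of T], of T] T by auto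
  have lim1: "E \<longlonglongrightarrow> expectation (\<lambda>\<omega>. G T \<omega> * exp (- \<mu> * U T \<omega>))"
    unfolding E_def
  proof (rule integral_dominated_convergence[where w = "\<lambda>_. exp (\<kappa> * T)"])
    show "AE \<omega> in M. (\<lambda>n. G T \<omega> * test_fun \<mu> (real (Suc n)) (U T \<omega>)) \<longlonglongrightarrow> G T \<omega> * exp (- \<mu> * U T \<omega>)"
      unfolding test_fun_def
      by (rule AE_I2) (intro tendsto_mult tendsto_const tendsto_mult[OF tendsto_const cutoff_tendsto, THEN tendsto_eq_rhs], simp)
    show "AE \<omega> in M. norm (G T \<omega> * test_fun \<mu> (real (Suc n)) (U T \<omega>)) \<le> exp (\<kappa> * T)" for n
    proof (rule AE_I2)
      fix \<omega> assume om: "\<omega> \<in> space M"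
      have "0 \<le> test_fun \<mu> (real (Suc n)) (U T \<omega>)" "test_fun \<mu> (real (Suc n)) (U T \<omega>) \<le> 1"
        using test_fun_bounds[of \<mu> "real (Suc n)" "U T \<omega>"] \<mu> U_nonneg[OF om T] by auto
      moreover have "0 \<le> G T \<omega>" "G T \<omega> \<le> exp (\<kappa> * T)" using Gb[OF om, of T] T by auto
      ultimately have "G T \<omega> * test_fun \<mu> (real (Suc n)) (U T \<omega>) \<le> exp (\<kappa> * T) * 1" by (intro mult_mono) auto
      with \<open>0 \<le> G T \<omega>\<close> \<open>0 \<le> test_fun \<mu> (real (Suc n)) (U T \<omega>)\<close>
      show "norm (G T \<omega> * test_fun \<mu> (real (Suc n)) (U T \<omega>)) \<le> exp (\<kappa> * T)" by (simp add: abs_mult)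
    qed
    show "(\<lambda>\<omega>. G T \<omega> * test_fun \<mu> (real (Suc n)) (U T \<omega>)) \<in> borel_measurable M" for n
      by (rule borel_measurable_times[OF GTm(1) measurable_compose[OF GTm(2) borel_measurable_continuous_onI[OF continuous_on_test_fun]]])
  qed (use GTm in simp_all)
  have t: "(\<lambda>n. test_fun \<mu> (real (Suc n)) u0) \<longlonglongrightarrow> exp (- \<mu> * u0)"
    unfolding test_fun_def by (rule tendsto_mult[OF tendsto_const cutoff_tendsto, THEN tendsto_eq_rhs]) simp
  have "(\<lambda>n. (18 + 12 * \<mu>) * L * (1 / real (Suc n))) \<longlonglongrightarrow> (18 + 12 * \<mu>) * L * 0"
    by (intro tendsto_intros LIMSEQ_Suc[OF lim_1_over_n])
  then have "(\<lambda>n. (18 + 12 * \<mu>) * L * (1 / real (Suc n))) \<longlonglongrightarrow> 0" by simp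
  then have "(\<lambda>n. E n - test_fun \<mu> (real (Suc n)) u0) \<longlonglongrightarrow> 0"
    by (rule Lim_null_comparison[rotated]) (use near in \<open>auto simp del: of_nat_Suc\<close>)
  from tendsto_add[OF this t] have "E \<longlonglongrightarrow> exp (- \<mu> * u0)" by simp
  from LIMSEQ_unique[OF lim1 this]
  have *: "expectation (\<lambda>\<omega>. G T \<omega> * exp (- \<mu> * U T \<omega>)) = exp (- \<mu> * u0)" .
  have "expectation (\<lambda>\<omega>. G T \<omega> * exp (- \<mu> * U T \<omega>)) =
      expectation (\<lambda>\<omega>. exp (\<kappa> * T) * (exp (- (\<mu>\<^sup>2 / 2) * clock T \<omega>) * exp (- \<mu> * U T \<omega>)))"
    by (rule Bochner_Integration.integral_cong) (use Geq[OF _ T] in simp_all)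
  also have "\<dots> = exp (\<kappa> * T) * expectation (\<lambda>\<omega>. exp (- (\<mu>\<^sup>2 / 2) * clock T \<omega>) * exp (- \<mu> * U T \<omega>))"
    by (rule integral_mult_right_zero)
  finally have "exp (\<kappa> * T) * expectation (\<lambda>\<omega>. exp (- (\<mu>\<^sup>2 / 2) * clock T \<omega>) * exp (- \<mu> * U T \<omega>)) = exp (- \<mu> * u0)"
    using * by simp
  then have "expectation (\<lambda>\<omega>. exp (- (\<mu>\<^sup>2 / 2) * clock T \<omega>) * exp (- \<mu> * U T \<omega>)) = exp (- \<mu> * u0) / exp (\<kappa> * T)"
    by (simp add: field_simps)
  then show ?thesis unfolding \<kappa>_def exp_diff .
qed

lemma laplace_integrable:
  assumes "0 \<le> T" "0 \<le> c"
  shows "integrable M (\<lambda>\<omega>. exp (- c * clock T \<omega>))"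
proof (rule integrable_const_bound[where B = 1])
  show "AE \<omega> in M. norm (exp (- c * clock T \<omega>)) \<le> 1"
    by (rule AE_I2) (use assms clock_nonneg in simp)
qed (use clock_measurable[OF assms(1)] in measurable)

lemma exponential_integrable:
  assumes "0 \<le> T" "0 \<le> \<mu>"
  shows "integrable M (\<lambda>\<omega>. exp (- \<mu> * U T \<omega>))"
proof (rule integrable_const_bound[where B = 1])
  show "AE \<omega> in M. norm (exp (- \<mu> * U T \<omega>)) \<le> 1"
    by (rule AE_I2) (use assms U_nonneg in simp)
  have "U T \<in> borel_measurable M" using cont_processD(1)[OF cont_process_U[of T], of T] assms by simp
  then show "(\<lambda>\<omega>. exp (- \<mu> * U T \<omega>)) \<in> borel_measurable M" by measurable
qed

lemma product_integrable:
  assumes "0 \<le> T" "0 \<le> \<mu>" "0 \<le> c"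
  shows "integrable M (\<lambda>\<omega>. exp (- c * clock T \<omega>) * exp (- \<mu> * U T \<omega>))"
proof (rule Bochner_Integration.integrable_bound[OF exponential_integrable[OF assms(1,2)]])
  show "AE \<omega> in M. norm (exp (- c * clock T \<omega>) * exp (- \<mu> * U T \<omega>)) \<le> norm (exp (- \<mu> * U T \<omega>))"
    by (rule AE_I2) (use assms clock_nonneg in simp)
qed (use borel_measurable_integrable[OF exponential_integrable[OF assms(1,2)]]
      borel_measurable_integrable[OF laplace_integrable[OF assms(1,3)]] in measurable)

lemma laplace_lower:
  assumes \<mu>: "0 < \<mu>" and T: "0 \<le> T"
  shows "exp (- \<mu> * u0 - 2 * \<mu> * (\<mu> + 1) * T) \<le> expectation (\<lambda>\<omega>. exp (- (\<mu>\<^sup>2 / 2) * clock T \<omega>))"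
  unfolding exponential_functional[OF assms, symmetric]
proof (rule integral_mono)
  show "exp (- (\<mu>\<^sup>2 / 2) * clock T \<omega>) * exp (- \<mu> * U T \<omega>) \<le> exp (- (\<mu>\<^sup>2 / 2) * clock T \<omega>)"
    if "\<omega> \<in> space M" for \<omega> using \<mu> U_nonneg[OF that T] by simp
qed (intro product_integrable laplace_integrable; use \<mu> T in simp)+

text \<open>
  For \<open>\<sigma> \<le> s \<le> T\<close> monotonicity of the clock and \<open>x \<le> x y + (1 - y)\<close> for \<open>x, y\<close> in \<open>[0, 1]\<close> bound the
  Laplace transform at \<open>T\<close> by the exponential functional at \<open>s\<close> plus \<open>E[1 - exp (- \<mu> U\<^sub>s)]\<close>; average over
  \<open>s\<close> and use the occupation bound.
\<close>

lemma laplace_upper: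
  assumes \<mu>: "0 < \<mu>" and st: "0 \<le> \<sigma>" "\<sigma> < T"
  shows "expectation (\<lambda>\<omega>. exp (- (\<mu>\<^sup>2 / 2) * clock T \<omega>)) \<le>
    exp (- 2 * \<mu> * (\<mu> + 1) * \<sigma>) + \<mu> / 2 * (1 + 4 * T) / (T - \<sigma>)"
proof -
  define a where "a = expectation (\<lambda>\<omega>. exp (- (\<mu>\<^sup>2 / 2) * clock T \<omega>))"
  define b where "b = exp (- 2 * \<mu> * (\<mu> + 1) * \<sigma>)"
  define e where "e s = expectation (\<lambda>\<omega>. 1 - exp (- \<mu> * U s \<omega>))" for s
  have T: "0 \<le> T" using st by simp
  have ui: "0 \<le> 1 - exp (- \<mu> * U s \<omega>)" "1 - exp (- \<mu> * U s \<omega>) \<le> 1" if "\<omega> \<in> space M" "0 \<le> s" for s \<omega>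
    using U_nonneg[OF that] \<mu> by simp_all
  have X: "cont_process M T (\<lambda>s \<omega>. 1 - exp (- \<mu> * U s \<omega>))"
    by (intro cont_process_compose[OF cont_process_U] continuous_intros)
  have i1: "integrable M (\<lambda>\<omega>. 1 - exp (- \<mu> * U s \<omega>))" if "0 \<le> s" for s
    using exponential_integrable[OF that] \<mu> by simp
  have e0: "0 \<le> e s" if "0 \<le> s" for s
    unfolding e_def using ui that by (intro integral_nonneg_AE AE_I2) auto
  have e1: "e s \<le> 1" if "0 \<le> s" for s
    unfolding e_def using ui that i1[OF that] by (intro integral_le_const AE_I2) auto
  have em: "(\<lambda>s. indicator {0..T} s * e s) \<in> borel_measurable lborel"
    using borel_measurable_lebesgue_integral[OF cont_process_joint_measurable[OF X T]] by (simp add: e_def)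
  have ei: "integrable lborel (\<lambda>s. indicator {0..T} s * e s)"
  proof (rule Bochner_Integration.integrable_bound[OF _ em])
    show "integrable lborel (\<lambda>s :: real. indicator {0..T} s :: real)" using T by simp
    show "AE s in lborel. norm (indicator {0..T} s * e s) \<le> norm (indicator {0..T} s :: real)"
      by (rule AE_I2) (use e0 e1 in \<open>auto simp: indicator_def\<close>)
  qed
  have "(LINT s:{0..T}|lborel. e s) = expectation (\<lambda>\<omega>. LINT s:{0..T}|lborel. 1 - exp (- \<mu> * U s \<omega>))"
    unfolding e_def
  proof (rule cont_process_Fubini(3)[OF X T, symmetric])
    fix \<omega> assume w: "\<omega> \<in> space M"
    have "(LINT s:{0..T}|lborel. \<bar>1 - exp (- \<mu> * U s \<omega>)\<bar>) \<le> (LINT s:{0..T}|lborel. 1)"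
    proof (rule integral_path_mono)
      show "continuous_on {0..T} (\<lambda>s. \<bar>1 - exp (- \<mu> * U s \<omega>)\<bar>)"
        by (rule continuous_on_rabs[OF cont_processD(2)[OF X w]])
    qed (use ui[OF w] in simp_all)
    then show "(LINT s:{0..T}|lborel. \<bar>1 - exp (- \<mu> * U s \<omega>)\<bar>) \<le> T" using T by (simp add: set_integral_const)
  qed
  also have "\<dots> \<le> \<mu> / 2 * (1 + 4 * T)" by (rule occupation_bound[OF \<mu> T])
  finally have E: "(LINT s:{0..T}|lborel. e s) \<le> \<mu> / 2 * (1 + 4 * T)" .
  have step: "a - b \<le> e s" if s: "\<sigma> \<le> s" "s \<le> T" for s
  proof -
    have s0: "0 \<le> s" using s st by simp
    have "a \<le> expectation (\<lambda>\<omega>. exp (- (\<mu>\<^sup>2 / 2) * clock s \<omega>) * exp (- \<mu> * U s \<omega>) + (1 - exp (- \<mu> * U s \<omega>)))"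
      unfolding a_def
    proof (rule integral_mono)
      fix \<omega> assume w: "\<omega> \<in> space M"
      define x y where "x = exp (- (\<mu>\<^sup>2 / 2) * clock s \<omega>)" and "y = exp (- \<mu> * U s \<omega>)"
      have "exp (- (\<mu>\<^sup>2 / 2) * clock T \<omega>) \<le> x"
        unfolding x_def using clock_mono[OF w s(2)] by (simp add: mult_left_mono)
      moreover have "x \<le> 1" unfolding x_def using clock_nonneg by simp
      moreover have "y \<le> 1" unfolding y_def using U_nonneg[OF w s0] \<mu> by simp
      moreover have "0 \<le> (1 - x) * (1 - y)" using calculation by simp
      ultimately show "exp (- (\<mu>\<^sup>2 / 2) * clock T \<omega>) \<le> exp (- (\<mu>\<^sup>2 / 2) * clock s \<omega>) * exp (- \<mu> * U s \<omega>) + (1 - exp (- \<mu> * U s \<omega>))"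
        unfolding x_def[symmetric] y_def[symmetric] by (simp add: algebra_simps)
    qed (intro Bochner_Integration.integrable_add product_integrable laplace_integrable i1; use s0 \<mu> T in simp)+
    also have "\<dots> = exp (- \<mu> * u0 - 2 * \<mu> * (\<mu> + 1) * s) + e s"
      unfolding e_def exponential_functional[OF \<mu> s0, symmetric]
      by (intro Bochner_Integration.integral_add product_integrable i1) (use s0 \<mu> in auto)
    also have "exp (- \<mu> * u0 - 2 * \<mu> * (\<mu> + 1) * s) \<le> b"
    proof -
      have "2 * \<mu> * (\<mu> + 1) * \<sigma> \<le> 2 * \<mu> * (\<mu> + 1) * s" using s \<mu> by (intro mult_left_mono) auto
      moreover have "0 \<le> \<mu> * u0" using \<mu> u0_nonneg by simp
      ultimately show ?thesis by (simp add: b_def)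
    qed
    finally show ?thesis by simp
  qed
  have "(T - \<sigma>) * (a - b) = (\<integral>s. indicator {\<sigma>..T} s * (a - b) \<partial>lborel)" using st by simp
  also have "\<dots> \<le> (\<integral>s. indicator {0..T} s * e s \<partial>lborel)"
  proof (rule integral_mono[OF _ ei])
    show "integrable lborel (\<lambda>s. indicator {\<sigma>..T} s * (a - b))" using st by simp
    show "indicator {\<sigma>..T} s * (a - b) \<le> indicator {0..T} s * e s" for s
      using step[of s] e0[of s] st by (auto simp: indicator_def)
  qed
  also have "\<dots> \<le> \<mu> / 2 * (1 + 4 * T)" using E by (simp add: set_lebesgue_integral_def)
  finally have "(a - b) * (T - \<sigma>) \<le> \<mu> / 2 * (1 + 4 * T)" by (simp only: mult.commute[of "a - b"])
  then have "a - b \<le> \<mu> / 2 * (1 + 4 * T) / (T - \<sigma>)"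
    using st by (simp only: pos_le_divide_eq diff_gt_0_iff_gt)
  then show ?thesis by (simp add: a_def b_def)
qed

text \<open>
  The window \<open>\<sigma> = t - sqrt t\<close> works because \<open>\<mu> \<sigma> \<rightarrow> l\<close> as \<open>\<sigma> / t \<rightarrow> 1\<close>, while the averaging error is of
  order \<open>\<mu> t / sqrt t = l / sqrt t\<close>.
\<close>

lemma laplace_limit:
  assumes l: "0 < l"
  shows "((\<lambda>t. expectation (\<lambda>\<omega>. exp (- ((l / t)\<^sup>2 / 2) * clock t \<omega>))) \<longlongrightarrow> exp (- 2 * l)) at_top"
proof (rule tendsto_sandwich)
  show "\<forall>\<^sub>F t in at_top. exp (- (l / t) * u0 - 2 * (l / t) * (l / t + 1) * t)
      \<le> expectation (\<lambda>\<omega>. exp (- ((l / t)\<^sup>2 / 2) * clock t \<omega>))"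
    using eventually_gt_at_top[of "0::real"] by eventually_elim (rule laplace_lower; use l in simp)
  show "\<forall>\<^sub>F t in at_top. expectation (\<lambda>\<omega>. exp (- ((l / t)\<^sup>2 / 2) * clock t \<omega>))
      \<le> exp (- 2 * (l / t) * (l / t + 1) * (t - sqrt t)) + l / t / 2 * (1 + 4 * t) / (t - (t - sqrt t))"
    using eventually_gt_at_top[of "1::real"]
  proof eventually_elim
    case (elim t)
    have "sqrt t \<le> t" using elim real_sqrt_le_mono[of t "t\<^sup>2"] self_le_power[of t 2] by simp
    then show ?case by (intro laplace_upper) (use l elim in auto)
  qed
  show "((\<lambda>t. exp (- (l / t) * u0 - 2 * (l / t) * (l / t + 1) * t)) \<longlongrightarrow> exp (- 2 * l)) at_top"
    using l by real_asymp
  show "((\<lambda>t. exp (- 2 * (l / t) * (l / t + 1) * (t - sqrt t)) + l / t / 2 * (1 + 4 * t) / (t - (t - sqrt t)))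
      \<longlongrightarrow> exp (- 2 * l)) at_top"
    using l by real_asymp
qed

end


section \<open>Brownian motion at an independent random time\<close>

lemma (in prob_space) brownian_char:
  assumes B: "std_brownian_motion M \<beta>" and s: "0 \<le> s"
  shows "expectation (\<lambda>\<omega>. iexp (\<theta> * \<beta> s \<omega>)) = complex_of_real (exp (- (\<theta>\<^sup>2 / 2) * s))"
proof -
  have [measurable]: "\<beta> 0 \<in> borel_measurable M" "\<beta> s \<in> borel_measurable M"
    using B s unfolding std_brownian_motion_def by auto
  have ae0: "AE \<omega> in M. \<beta> 0 \<omega> = 0" using B unfolding std_brownian_motion_def by auto
  have inc: "expectation (\<lambda>\<omega>. iexp (\<theta> * \<beta> s \<omega>)) = expectation (\<lambda>\<omega>. iexp (\<theta> * (\<beta> s \<omega> - \<beta> 0 \<omega>)))"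
    by (rule integral_cong_AE) (use ae0 in \<open>auto elim!: eventually_mono\<close>)
  show ?thesis
  proof (cases "s = 0")
    case True
    then show ?thesis using inc by (simp add: prob_space)
  next
    case False
    with s have s: "0 < s" by simp
    have "distributed M lborel (\<lambda>\<omega>. \<beta> s \<omega> - \<beta> 0 \<omega>) (normal_density 0 (sqrt (s - 0)))"
      using B s unfolding std_brownian_motion_def by blast
    then have "distributed M lborel (\<lambda>\<omega>. (\<beta> s \<omega> - \<beta> 0 \<omega> - 0) / sqrt s) std_normal_density"
      using normal_standard_normal_convert[of "sqrt s" "\<lambda>\<omega>. \<beta> s \<omega> - \<beta> 0 \<omega>" 0] s by simp
    then have d: "distr M lborel (\<lambda>\<omega>. (\<beta> s \<omega> - \<beta> 0 \<omega>) / sqrt s) = std_normal_distribution"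
      using distributed_distr_eq_density by fastforce
    have "expectation (\<lambda>\<omega>. iexp (\<theta> * (\<beta> s \<omega> - \<beta> 0 \<omega>))) =
        expectation (\<lambda>\<omega>. iexp ((\<theta> * sqrt s) * ((\<beta> s \<omega> - \<beta> 0 \<omega>) / sqrt s)))"
      using s by simp
    also have "\<dots> = char (distr M lborel (\<lambda>\<omega>. (\<beta> s \<omega> - \<beta> 0 \<omega>) / sqrt s)) (\<theta> * sqrt s)"
      unfolding char_def by (subst integral_distr) auto
    also have "\<dots> = complex_of_real (exp (- ((\<theta> * sqrt s)\<^sup>2) / 2))"
      unfolding d char_std_normal_distribution ..
    also have "(\<theta> * sqrt s)\<^sup>2 = \<theta>\<^sup>2 * s" using s by (simp add: power_mult_distrib)
    finally show ?thesis using inc by simp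
  qed
qed

text \<open>
  Evaluating a path at a time is not a measurable operation on the product space of all paths, so the
  law of \<open>\<beta>\<close> at the random time \<open>A\<close> cannot be had by Fubini on that space. Instead \<open>A\<close> is approximated
  by \<open>D n\<close>, a function of \<open>An n\<close> with finitely many values, for which independence at single times
  suffices; continuity of \<open>\<beta>\<close> gives the limit. The approximations \<open>An\<close> are part of the statement because
  the clock is a limit of functionals of the path of \<open>r\<close> that are measurable on the product space, but
  not such a functional itself.
\<close>

lemma (in prob_space) brownian_time_change_measurable_and_char:
  fixes A :: "'a \<Rightarrow> real" and An :: "nat \<Rightarrow> 'a \<Rightarrow> real"
  assumes B: "std_brownian_motion M \<beta>"
    and ind: "\<And>n s. 0 \<le> s \<Longrightarrow> indep_var borel (An n) borel (\<beta> s)"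
    and nn: "\<And>n \<omega>. 0 \<le> An n \<omega>"
    and lim: "\<And>\<omega>. \<omega> \<in> space M \<Longrightarrow> (\<lambda>n. An n \<omega>) \<longlonglongrightarrow> A \<omega>"
  shows "(\<lambda>\<omega>. \<beta> (A \<omega>) \<omega>) \<in> borel_measurable M"
    and "expectation (\<lambda>\<omega>. iexp (\<theta> * \<beta> (A \<omega>) \<omega>)) = complex_of_real (expectation (\<lambda>\<omega>. exp (- (\<theta>\<^sup>2 / 2) * A \<omega>)))"
proof -
  \<comment> \<open>the minimum keeps the range finite; it is eventually inactive, since \<open>D n\<close> is only capped at \<open>n + 1\<close>\<close>
  define K where "K n \<omega> = min (Suc n * Suc n) (nat \<lceil>real (Suc n) * An n \<omega>\<rceil>)" for n \<omega>
  define D where "D n \<omega> = real (K n \<omega>) / real (Suc n)" for n \<omega>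
  have Bm: "\<beta> s \<in> borel_measurable M" if "0 \<le> s" for s using B that unfolding std_brownian_motion_def by auto
  have Bc: "continuous_on {0..} (\<lambda>t. \<beta> t \<omega>)" if "\<omega> \<in> space M" for \<omega>
    using B that unfolding std_brownian_motion_def by auto
  have [measurable]: "An n \<in> borel_measurable M" for n using indep_var_rv1[OF ind[of 0 n]] by simp
  have [measurable]: "A \<in> borel_measurable M" by (rule borel_measurable_LIMSEQ_real[OF lim]) auto
  have A0: "0 \<le> A \<omega>" if "\<omega> \<in> space M" for \<omega> by (rule LIMSEQ_le_const[OF lim[OF that]]) (use nn in auto)
  have Km: "K n \<in> measurable M (count_space UNIV)" for n
    unfolding K_def[abs_def] by measurable
  have [measurable]: "D n \<in> borel_measurable M" for n
    unfolding D_def[abs_def] using measurable_compose[OF Km[of n], of "\<lambda>k. real k / real (Suc n)" borel] by simp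
  have D0: "0 \<le> D n \<omega>" for n \<omega> by (simp add: D_def)
  have Dlim: "(\<lambda>n. D n \<omega>) \<longlonglongrightarrow> A \<omega>" if w: "\<omega> \<in> space M" for \<omega>
  proof -
    have c: "(\<lambda>n. real (nat \<lceil>real (Suc n) * An n \<omega>\<rceil>) / real (Suc n)) \<longlonglongrightarrow> A \<omega>"
    proof (rule tendsto_sandwich)
      show "\<forall>\<^sub>F n in sequentially. An n \<omega> \<le> real (nat \<lceil>real (Suc n) * An n \<omega>\<rceil>) / real (Suc n)"
        by (intro always_eventually allI) (simp only: pos_le_divide_eq of_nat_0_less_iff zero_less_Suc mult.commute[of "An _ _"] real_nat_ceiling_ge)
      show "\<forall>\<^sub>F n in sequentially. real (nat \<lceil>real (Suc n) * An n \<omega>\<rceil>) / real (Suc n) \<le> An n \<omega> + 1 / real (Suc n)"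
      proof (intro always_eventually allI)
        fix n
        have "0 \<le> real (Suc n) * An n \<omega>" using nn by simp
        then have "real (nat \<lceil>real (Suc n) * An n \<omega>\<rceil>) \<le> real (Suc n) * An n \<omega> + 1" by linarith
        then have "real (nat \<lceil>real (Suc n) * An n \<omega>\<rceil>) / real (Suc n) \<le> (real (Suc n) * An n \<omega> + 1) / real (Suc n)"
          by (rule divide_right_mono) simp
        also have "\<dots> = An n \<omega> + 1 / real (Suc n)" by (simp add: add_divide_distrib)
        finally show "real (nat \<lceil>real (Suc n) * An n \<omega>\<rceil>) / real (Suc n) \<le> An n \<omega> + 1 / real (Suc n)" .
      qed
      have "(\<lambda>n. An n \<omega> + 1 / real (Suc n)) \<longlonglongrightarrow> A \<omega> + 0"
        by (intro tendsto_add lim w LIMSEQ_Suc[OF lim_1_over_n])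
      then show "(\<lambda>n. An n \<omega> + 1 / real (Suc n)) \<longlonglongrightarrow> A \<omega>" by simp
    qed (rule lim[OF w])
    have "\<forall>\<^sub>F n in sequentially. real (nat \<lceil>real (Suc n) * An n \<omega>\<rceil>) / real (Suc n) < A \<omega> + 1"
      using order_tendstoD(2)[OF c, of "A \<omega> + 1"] by simp
    moreover have "\<forall>\<^sub>F n in sequentially. A \<omega> + 1 \<le> real n"
      using filterlim_real_sequentially unfolding filterlim_at_top by blast
    ultimately have "\<forall>\<^sub>F n in sequentially. real (nat \<lceil>real (Suc n) * An n \<omega>\<rceil>) / real (Suc n) = D n \<omega>"
    proof eventually_elim
      case (elim n)
      then have "real (nat \<lceil>real (Suc n) * An n \<omega>\<rceil>) / real (Suc n) < real (Suc n)" by simp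
      then have "real (nat \<lceil>real (Suc n) * An n \<omega>\<rceil>) < real (Suc n * Suc n)"
        by (simp only: pos_divide_less_eq of_nat_0_less_iff zero_less_Suc of_nat_mult)
      then have "K n \<omega> = nat \<lceil>real (Suc n) * An n \<omega>\<rceil>" unfolding K_def of_nat_less_iff by simp
      then show ?case by (simp add: D_def)
    qed
    from Lim_transform_eventually[OF c this] show ?thesis .
  qed
  have Blim: "(\<lambda>n. \<beta> (D n \<omega>) \<omega>) \<longlonglongrightarrow> \<beta> (A \<omega>) \<omega>" if w: "\<omega> \<in> space M" for \<omega>
    by (rule continuous_on_tendsto_compose[OF Bc[OF w] Dlim[OF w]]) (use A0[OF w] D0 in auto)
  have BDm: "(\<lambda>\<omega>. \<beta> (D n \<omega>) \<omega>) \<in> borel_measurable M" for n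
    unfolding D_def using measurable_compose_countable[of "\<lambda>k. \<beta> (real k / real (Suc n))" M borel, OF Bm Km[of n]] by simp
  show m: "(\<lambda>\<omega>. \<beta> (A \<omega>) \<omega>) \<in> borel_measurable M"
    by (rule borel_measurable_LIMSEQ_real[OF Blim BDm])
  have eq: "expectation (\<lambda>\<omega>. iexp (\<theta> * \<beta> (D n \<omega>) \<omega>)) =
      expectation (\<lambda>\<omega>. complex_of_real (exp (- (\<theta>\<^sup>2 / 2) * D n \<omega>)))" for n
  proof -
    define I where "I k \<omega> = (indicator {x. min (Suc n * Suc n) (nat \<lceil>real (Suc n) * x\<rceil>) = k} (An n \<omega>) :: complex)" for k \<omega>
    have I: "I k \<omega> = (if K n \<omega> = k then 1 else 0)" for k \<omega> by (simp add: I_def K_def)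
    have set: "{x. min (Suc n * Suc n) (nat \<lceil>real (Suc n) * x\<rceil>) = k} \<in> sets borel" for k
      by measurable
    have Im: "I k \<in> borel_measurable M" for k
      unfolding I_def[abs_def] by (rule measurable_compose[OF _ borel_measurable_indicator[OF set]]) measurable
    have Ii: "integrable M (I k)" for k
      by (rule integrable_const_bound[where B = 1]) (use Im in \<open>auto simp: I\<close>)
    define s where "s k = real k / real (Suc n)" for k
    have s0: "0 \<le> s k" for k by (simp add: s_def)
    note [measurable] = Bm[OF s0]
    \<comment> \<open>splitting according to the value of \<open>K n\<close> puts deterministic times into \<open>\<beta>\<close>\<close>
    have sumI: "f (K n \<omega>) = (\<Sum>k\<le>Suc n * Suc n. I k \<omega> * f k)" for f :: "nat \<Rightarrow> complex" and \<omega>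
    proof -
      have "(\<Sum>k\<le>Suc n * Suc n. I k \<omega> * f k) = (\<Sum>k\<le>Suc n * Suc n. if k = K n \<omega> then f k else 0)"
        by (intro sum.cong refl) (auto simp: I)
      also have "\<dots> = f (K n \<omega>)" by (subst sum.delta) (auto simp: K_def)
      finally show ?thesis ..
    qed
    have ei: "integrable M (\<lambda>\<omega>. iexp (\<theta> * \<beta> (s k) \<omega>))" for k
      by (rule integrable_const_bound[where B = 1]) auto
    have iv: "indep_var borel (I k) borel (\<lambda>\<omega>. iexp (\<theta> * \<beta> (s k) \<omega>))" for k
      using indep_var_compose[OF ind[OF s0] borel_measurable_indicator[OF set], of "\<lambda>x. iexp (\<theta> * x)" borel]
      by (simp add: I_def[abs_def] comp_def)
    have "expectation (\<lambda>\<omega>. iexp (\<theta> * \<beta> (D n \<omega>) \<omega>)) =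
        expectation (\<lambda>\<omega>. \<Sum>k\<le>Suc n * Suc n. I k \<omega> * iexp (\<theta> * \<beta> (s k) \<omega>))"
      by (rule Bochner_Integration.integral_cong[OF refl]) (simp only: D_def s_def sumI[of "\<lambda>k. iexp (\<theta> * \<beta> (real k / real (Suc n)) _)"])
    also have "\<dots> = (\<Sum>k\<le>Suc n * Suc n. expectation (\<lambda>\<omega>. I k \<omega> * iexp (\<theta> * \<beta> (s k) \<omega>)))"
      by (rule Bochner_Integration.integral_sum) (rule indep_var_integrable[OF iv Ii ei])
    also have "\<dots> = (\<Sum>k\<le>Suc n * Suc n. expectation (I k) * complex_of_real (exp (- (\<theta>\<^sup>2 / 2) * s k)))"
      by (simp only: indep_var_lebesgue_integral[OF iv Ii ei] brownian_char[OF B s0])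
    also have "\<dots> = (\<Sum>k\<le>Suc n * Suc n. expectation (\<lambda>\<omega>. I k \<omega> * complex_of_real (exp (- (\<theta>\<^sup>2 / 2) * s k))))"
      by simp
    also have "\<dots> = expectation (\<lambda>\<omega>. \<Sum>k\<le>Suc n * Suc n. I k \<omega> * complex_of_real (exp (- (\<theta>\<^sup>2 / 2) * s k)))"
      by (rule Bochner_Integration.integral_sum[symmetric]) (rule integrable_mult_left[OF Ii])
    also have "\<dots> = expectation (\<lambda>\<omega>. complex_of_real (exp (- (\<theta>\<^sup>2 / 2) * D n \<omega>)))"
      by (rule Bochner_Integration.integral_cong[OF refl]) (simp only: D_def s_def sumI[of "\<lambda>k. complex_of_real (exp (- (\<theta>\<^sup>2 / 2) * (real k / real (Suc n))))"])
    finally show ?thesis .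
  qed
  have "(\<lambda>n. expectation (\<lambda>\<omega>. iexp (\<theta> * \<beta> (D n \<omega>) \<omega>))) \<longlonglongrightarrow> expectation (\<lambda>\<omega>. iexp (\<theta> * \<beta> (A \<omega>) \<omega>))"
    by (rule integral_dominated_convergence[where w = "\<lambda>_. 1"])
       (use m BDm Blim in \<open>auto intro!: AE_I2 tendsto_intros\<close>)
  moreover have "(\<lambda>n. expectation (\<lambda>\<omega>. iexp (\<theta> * \<beta> (D n \<omega>) \<omega>))) \<longlonglongrightarrow>
      expectation (\<lambda>\<omega>. complex_of_real (exp (- (\<theta>\<^sup>2 / 2) * A \<omega>)))"
    unfolding eq
  proof (rule integral_dominated_convergence[where w = "\<lambda>_. 1"])
    show "AE \<omega> in M. (\<lambda>n. complex_of_real (exp (- (\<theta>\<^sup>2 / 2) * D n \<omega>))) \<longlonglongrightarrow> complex_of_real (exp (- (\<theta>\<^sup>2 / 2) * A \<omega>))"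
      by (rule AE_I2) (intro tendsto_intros Dlim)
    show "AE \<omega> in M. norm (complex_of_real (exp (- (\<theta>\<^sup>2 / 2) * D n \<omega>))) \<le> 1" for n
      by (rule AE_I2) (use D0 in simp)
  qed measurable
  ultimately have "expectation (\<lambda>\<omega>. iexp (\<theta> * \<beta> (A \<omega>) \<omega>)) = expectation (\<lambda>\<omega>. complex_of_real (exp (- (\<theta>\<^sup>2 / 2) * A \<omega>)))"
    by (rule LIMSEQ_unique)
  then show "expectation (\<lambda>\<omega>. iexp (\<theta> * \<beta> (A \<omega>) \<omega>)) = complex_of_real (expectation (\<lambda>\<omega>. exp (- (\<theta>\<^sup>2 / 2) * A \<omega>)))"
    by (simp only: integral_complex_of_real)
qed

context jacobi_process
begin

text \<open>
  Rounding the times to a grid makes this a function of countably many coordinates of the path, hence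
  measurable for the product sigma-algebra.
\<close>

definition clock_functional :: "real \<Rightarrow> nat \<Rightarrow> (real \<Rightarrow> real) \<Rightarrow> real" where
  "clock_functional t n p = (LINT s:{0..t}|lborel. 4 / (sin (2 * p (grid t n s)))\<^sup>2)"

lemma clock_functional_measurable:
  assumes t: "0 \<le> t"
  shows "clock_functional t n \<in> borel_measurable (\<Pi>\<^sub>M s\<in>{0..}. borel)"
proof -
  let ?P = "\<Pi>\<^sub>M s\<in>{0 :: real..}. (borel :: real measure)"
  have "(\<lambda>q. (\<lambda>s p. p s) (grid t n (fst q)) (snd q)) \<in> borel_measurable (lborel \<Otimes>\<^sub>M ?P)"
    by (rule grid_process_measurable[OF _ t]) (rule measurable_component_singleton, simp)
  from measurable_pair_swap[OF this]
  have [measurable]: "(\<lambda>q. fst q (grid t n (snd q))) \<in> borel_measurable (?P \<Otimes>\<^sub>M lborel)"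
    by (simp add: case_prod_beta)
  have "(\<lambda>(p, s). indicator {0..t} s * (4 / (sin (2 * p (grid t n s)))\<^sup>2)) \<in> borel_measurable (?P \<Otimes>\<^sub>M lborel)"
    unfolding case_prod_beta by measurable
  from lborel.borel_measurable_lebesgue_integral[OF this]
  show ?thesis unfolding clock_functional_def[abs_def] set_lebesgue_integral_def by simp
qed

lemma clock_functional_tendsto:
  assumes w: "\<omega> \<in> space M" and t: "0 \<le> t"
  shows "(\<lambda>n. clock_functional t n (\<lambda>s\<in>{0..}. r s \<omega>)) \<longlonglongrightarrow> clock t \<omega>"
proof -
  define v where "v s = 4 / (sin (2 * r s \<omega>))\<^sup>2" for s
  have v: "continuous_on {0..t} v" unfolding v_def
    by (intro continuous_intros continuous_on_subset[OF r_cont[OF w]]) (use sin_r_pos[OF w] in \<open>auto simp: less_le\<close>)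
  have "bounded (v ` {0..t})" by (intro compact_imp_bounded compact_continuous_image v) simp
  then obtain C where C: "\<And>s. s \<in> {0..t} \<Longrightarrow> \<bar>v s\<bar> \<le> C" unfolding bounded_iff by fastforce
  have g: "grid t n s \<in> {0..t}" for n s using grid_bounds[OF t] by simp
  have e: "clock_functional t n (\<lambda>s\<in>{0..}. r s \<omega>) = (LINT s:{0..t}|lborel. v (grid t n s))" for n
    unfolding clock_functional_def v_def using g[of n] by simp
  show ?thesis
    unfolding e clock_def v_def[symmetric] set_lebesgue_integral_def
  proof (rule integral_dominated_convergence[where w = "\<lambda>s. indicator {0..t} s * C"])
    show "AE s in lborel. (\<lambda>n. indicator {0..t} s *\<^sub>R v (grid t n s)) \<longlonglongrightarrow> indicator {0..t} s *\<^sub>R v s"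
    proof (rule AE_I2)
      fix s :: real
      have "(\<lambda>n. v (grid t n s)) \<longlonglongrightarrow> v (max 0 (min t s))"
        by (rule continuous_on_tendsto_compose[OF v grid_tendsto]) (use g t in auto)
      then show "(\<lambda>n. indicator {0..t} s *\<^sub>R v (grid t n s)) \<longlonglongrightarrow> indicator {0..t} s *\<^sub>R v s"
        by (auto simp: indicator_def)
    qed
    show "AE s in lborel. norm (indicator {0..t} s *\<^sub>R v (grid t n s)) \<le> indicator {0..t} s * C" for n
      by (rule AE_I2) (use C[OF g] in \<open>auto simp: indicator_def\<close>)
    show "(\<lambda>s. indicator {0..t} s *\<^sub>R v s) \<in> borel_measurable lborel"
      using borel_integrable_atLeastAtMost'[OF v] unfolding set_integrable_def by (rule borel_measurable_integrable)
    show "(\<lambda>s. indicator {0..t} s *\<^sub>R v (grid t n s)) \<in> borel_measurable lborel" for n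
    proof -
      \<comment> \<open>the rounded path is a step function; it is viewed as a process over a one-point space\<close>
      have "(\<lambda>q. (\<lambda>s (_ :: unit). v (max 0 (min t s))) (grid t n (fst q)) (snd q)) \<in> borel_measurable (lborel \<Otimes>\<^sub>M count_space UNIV)"
        by (rule grid_process_measurable[OF _ t]) simp
      from measurable_compose[OF measurable_Pair[OF measurable_ident measurable_const[of "()"]] this]
      have "(\<lambda>s. v (max 0 (min t (grid t n s)))) \<in> borel_measurable lborel" by simp
      moreover have "v (max 0 (min t (grid t n s))) = v (grid t n s)" for s using g[of n s] by auto
      ultimately have [measurable]: "(\<lambda>s. v (grid t n s)) \<in> borel_measurable lborel" by simp
      show ?thesis by measurable
    qed
  qed (use t in simp)
qed

lemma winding_measurable_and_char:
  assumes B: "std_brownian_motion M \<beta>" and ind: "independent_processes M r \<beta>" and t: "0 \<le> t"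
  shows "(\<lambda>\<omega>. \<beta> (clock t \<omega>) \<omega>) \<in> borel_measurable M"
    and "expectation (\<lambda>\<omega>. iexp (\<theta> * \<beta> (clock t \<omega>) \<omega>)) =
      complex_of_real (expectation (\<lambda>\<omega>. exp (- (\<theta>\<^sup>2 / 2) * clock t \<omega>)))"
proof -
  define An where "An n \<omega> = clock_functional t n (\<lambda>s\<in>{0..}. r s \<omega>)" for n \<omega>
  have i: "indep_var borel (An n) borel (\<beta> s)" if s: "0 \<le> s" for n s
  proof -
    have m: "(\<lambda>p. p s) \<in> measurable (\<Pi>\<^sub>M s\<in>{0..}. borel) (borel :: real measure)"
      by (rule measurable_component_singleton) (use s in simp)
    from indep_var_compose[OF ind[unfolded independent_processes_def] clock_functional_measurable[OF t] m]
    show ?thesis using s by (simp add: comp_def An_def[abs_def])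
  qed
  have nn: "0 \<le> An n \<omega>" for n \<omega>
    unfolding An_def clock_functional_def set_lebesgue_integral_def by (intro integral_nonneg_AE AE_I2) auto
  have l: "(\<lambda>n. An n \<omega>) \<longlonglongrightarrow> clock t \<omega>" if "\<omega> \<in> space M" for \<omega>
    unfolding An_def by (rule clock_functional_tendsto[OF that t])
  show "(\<lambda>\<omega>. \<beta> (clock t \<omega>) \<omega>) \<in> borel_measurable M"
    by (rule brownian_time_change_measurable_and_char(1)[OF B i nn l])
  show "expectation (\<lambda>\<omega>. iexp (\<theta> * \<beta> (clock t \<omega>) \<omega>)) =
      complex_of_real (expectation (\<lambda>\<omega>. exp (- (\<theta>\<^sup>2 / 2) * clock t \<omega>)))"
    by (rule brownian_time_change_measurable_and_char(2)[OF B i nn l])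
qed

end

theorem theorem4p1:
  fixes M :: "'a measure" and \<phi> :: "real \<Rightarrow> 'a \<Rightarrow> real" and r0 :: real and C2 :: "real measure"
  assumes "prob_space M"
    and "0 < r0" and "r0 < pi / 2"
    and "CP1_winding_process M r0 \<phi>"
    and "cauchy_distribution 2 C2"
  shows "converges_in_distribution M (\<lambda>t \<omega>. \<phi> t \<omega> / t) C2 at_top"
proof -
  from assms(4) obtain r \<beta> where r: "jacobi_diffusion M r0 r" and B: "std_brownian_motion M \<beta>"
    and ind: "independent_processes M r \<beta>"
    and \<phi>: "\<And>t \<omega>. 0 \<le> t \<Longrightarrow> \<omega> \<in> space M \<Longrightarrow> \<phi> t \<omega> = \<beta> (LINT s:{0..t}|lborel. 4 / (sin (2 * r s \<omega>))\<^sup>2) \<omega>"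
    unfolding CP1_winding_process_def by auto
  interpret jacobi_process M r0 r
    using assms(1-3) r by (simp add: jacobi_process_def jacobi_process_axioms_def)
  have C2: "real_distribution C2" "\<And>l. char C2 l = complex_of_real (exp (- 2 * \<bar>l\<bar>))"
    using assms(5) by (simp_all add: cauchy_distribution_def)
  have \<phi>c: "\<phi> t \<omega> = \<beta> (clock t \<omega>) \<omega>" if "0 \<le> t" "\<omega> \<in> space M" for t \<omega>
    using \<phi>[OF that] by (simp add: clock_def)
  have \<phi>m: "(\<lambda>\<omega>. \<phi> t \<omega> / t) \<in> borel_measurable M" if t: "0 \<le> t" for t
  proof -
    have "(\<lambda>\<omega>. \<beta> (clock t \<omega>) \<omega> / t) \<in> borel_measurable M"
      using winding_measurable_and_char(1)[OF B ind t] by measurable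
    then show ?thesis using \<phi>c[OF t] by (simp cong: measurable_cong)
  qed
  have char: "char (distr M borel (\<lambda>\<omega>. \<phi> t \<omega> / t)) l =
      complex_of_real (expectation (\<lambda>\<omega>. exp (- ((\<bar>l\<bar> / t)\<^sup>2 / 2) * clock t \<omega>)))" if t: "0 \<le> t" for t l
  proof -
    have "char (distr M borel (\<lambda>\<omega>. \<phi> t \<omega> / t)) l = expectation (\<lambda>\<omega>. iexp (l * (\<phi> t \<omega> / t)))"
      unfolding char_def using \<phi>m[OF t] by (subst integral_distr) auto
    also have "\<dots> = expectation (\<lambda>\<omega>. iexp ((l / t) * \<beta> (clock t \<omega>) \<omega>))"
      by (rule Bochner_Integration.integral_cong[OF refl]) (simp add: \<phi>c[OF t])
    also have "\<dots> = complex_of_real (expectation (\<lambda>\<omega>. exp (- ((l / t)\<^sup>2 / 2) * clock t \<omega>)))"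
      by (rule winding_measurable_and_char(2)[OF B ind t])
    finally show ?thesis by (simp add: power_divide)
  qed
  have char_lim: "((\<lambda>t. char (distr M borel (\<lambda>\<omega>. \<phi> t \<omega> / t)) l) \<longlongrightarrow> char C2 l) at_top" for l
  proof -
    have "((\<lambda>t. expectation (\<lambda>\<omega>. exp (- ((\<bar>l\<bar> / t)\<^sup>2 / 2) * clock t \<omega>))) \<longlongrightarrow> exp (- 2 * \<bar>l\<bar>)) at_top"
      using laplace_limit[of "\<bar>l\<bar>"] by (cases "l = 0") (simp_all add: prob_space)
    then have "((\<lambda>t. complex_of_real (expectation (\<lambda>\<omega>. exp (- ((\<bar>l\<bar> / t)\<^sup>2 / 2) * clock t \<omega>)))) \<longlongrightarrow> char C2 l) at_top"
      unfolding C2(2) by (rule tendsto_of_real)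
    then show ?thesis
    proof (rule Lim_transform_eventually)
      show "\<forall>\<^sub>F t in at_top. complex_of_real (expectation (\<lambda>\<omega>. exp (- ((\<bar>l\<bar> / t)\<^sup>2 / 2) * clock t \<omega>))) =
          char (distr M borel (\<lambda>\<omega>. \<phi> t \<omega> / t)) l"
        using eventually_ge_at_top[of "0::real"] by eventually_elim (simp only: char)
    qed
  qed
  show ?thesis
    unfolding converges_in_distribution_def
  proof (intro allI impI)
    fix x assume x: "isCont (cdf C2) x"
    show "((\<lambda>t. cdf (distr M borel (\<lambda>\<omega>. \<phi> t \<omega> / t)) x) \<longlongrightarrow> cdf C2 x) at_top"
    proof (rule tendsto_at_topI_sequentially)
      fix X :: "nat \<Rightarrow> real" assume X: "filterlim X at_top sequentially"
      \<comment> \<open>\<open>\<phi>\<close> is given by the skew product, and known to be measurable, for nonnegative times only\<close>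
      define Y where "Y n = max 0 (X n)" for n
      have ev: "\<forall>\<^sub>F n in sequentially. X n = Y n"
        using X[unfolded filterlim_at_top, rule_format, of 0] by eventually_elim (simp add: Y_def)
      have Y: "filterlim Y at_top sequentially"
        using X filterlim_cong[OF refl refl ev] by simp
      have "weak_conv_m (\<lambda>n. distr M borel (\<lambda>\<omega>. \<phi> (Y n) \<omega> / Y n)) C2"
      proof (rule levy_continuity[OF _ C2(1)])
        show "real_distribution (distr M borel (\<lambda>\<omega>. \<phi> (Y n) \<omega> / Y n))" for n
          by (rule real_distribution_distr[OF \<phi>m]) (simp add: Y_def)
        show "(\<lambda>n. char (distr M borel (\<lambda>\<omega>. \<phi> (Y n) \<omega> / Y n)) l) \<longlonglongrightarrow> char C2 l" for l
          by (rule filterlim_compose[OF char_lim Y])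
      qed
      then have "(\<lambda>n. cdf (distr M borel (\<lambda>\<omega>. \<phi> (Y n) \<omega> / Y n)) x) \<longlonglongrightarrow> cdf C2 x"
        using x by (simp add: weak_conv_m_def weak_conv_def)
      then show "(\<lambda>n. cdf (distr M borel (\<lambda>\<omega>. \<phi> (X n) \<omega> / X n)) x) \<longlonglongrightarrow> cdf C2 x"
        by (rule Lim_transform_eventually) (use ev in eventually_elim, simp)
    qed
  qed
qed

end
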